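(* Let $G=(V,E,\mu,w)$ be a weighted graph with $n$ vertices and $c$ connected components satisfying $\mu_v=\sum_{u\in V:\{u,v\}\in E}w_{uv}$ for all $v\in V$, and let $\beta=|E|-|V|+c$. Then for every $p\ge1$ and every $k\in\{1,\dots,n\}$, $$\lambda_k(\Delta_p)\le 2^{p-1}h_k(G),$$ and, whenever $k-\beta\ge1$, $$\frac{2^{p-1}}{p^p}\,h_{k-\beta}(G)^p\le\lambda_k(\Delta_p).$$
   Context: A weighted graph is a quadruple $G=(V,E,\mu,w)$ with finite vertex set $V=\{1,\dots,n\}$, edge set $E\subseteq\{\{u,v\}:u\neq v\text{ in }V\}$, vertex weight $\mu:V\to(0,\infty)$ and edge weight $w:E\to(0,\infty)$; write $\mu_v=\mu(v)$, $w_{uv}=w(\{u,v\})$. For nonempty $A\subseteq V$, $\partial A=\{\{u,v\}\in E:u\in A,\ v\notin A\}$ and $\phi(A)=\dfrac{\sum_{\{u,v\}\in\partial A}w_{uv}}{\sum_{v\in A}\mu_v}$. The Cheeger $k$-constant is $h_k(G)=\min\max_{1\le i\le k}\phi(A_i)$, the minimum being over all $k$-tuples $(A_1,\dots,A_k)$ of pairwise disjoint nonempty subsets of $V$ ($1\le k\le n$). The $k$-th min-max eigenvalue of the graph $p$-Laplacian is $$\lambda_k(\Delta_p)=\inf_{S}\ \max_{x\in S}\frac{\sum_{\{u,v\}\in E}w_{uv}|x_u-x_v|^p}{\sum_{v\in V}\mu_v|x_v|^p},$$ the infimum over all nonempty compact $S\subset\mathbb R^n\setminus\{0\}$ with $S=-S$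 and $\gamma(S)\ge k$, where $\gamma(S)=\min\{m\in\mathbb Z^+:\text{there is an odd continuous map }S\to\mathbb R^m\setminus\{0\}\}$ is the Krasnoselskii genus. *)

theory Defs
  imports "HOL-Analysis.Analysis"
begin

text \<open>
  The vertex set is \<open>UNIV\<close> of a finite type \<open>'n\<close>, so that the number of vertices is
  \<open>CARD('n)\<close> and functions on the vertices are the elements of \<open>real ^ 'n\<close>.  Edges are
  two-element sets of vertices; the values of \<open>w\<close> outside \<open>E\<close> are irrelevant.
\<close>

locale weighted_graph =
  fixes E :: "'n::finite set set" and \<mu> :: "'n \<Rightarrow> real" and w :: "'n set \<Rightarrow> real"
  assumes edge: "e \<in> E \<Longrightarrow> \<exists>u v. u \<noteq> v \<and> e = {u, v}"
    and vertex_weight_pos: "\<mu> v > 0"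
    and edge_weight_pos: "e \<in> E \<Longrightarrow> w e > 0"

definition num_components :: "'n::finite set set \<Rightarrow> nat" where
  "num_components E = card (UNIV // {(u, v). {u, v} \<in> E}\<^sup>*)"

definition cycle_rank :: "'n::finite set set \<Rightarrow> int" where
  "cycle_rank E = int (card E) - int CARD('n) + int (num_components E)"

definition edge_boundary :: "'n::finite set set \<Rightarrow> 'n set \<Rightarrow> 'n set set" where
  "edge_boundary E A = {{u, v} | u v. {u, v} \<in> E \<and> u \<in> A \<and> v \<notin> A}"

definition expansion ::
  "'n::finite set set \<Rightarrow> ('n \<Rightarrow> real) \<Rightarrow> ('n set \<Rightarrow> real) \<Rightarrow> 'n set \<Rightarrow> real" where
  "expansion E \<mu> w A = (\<Sum>e\<in>edge_boundary E A. w e) / (\<Sum>v\<in>A. \<mu> v)"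

definition cheeger_constant ::
  "'n::finite set set \<Rightarrow> ('n \<Rightarrow> real) \<Rightarrow> ('n set \<Rightarrow> real) \<Rightarrow> nat \<Rightarrow> real" where
  "cheeger_constant E \<mu> w k =
     Min {Max ((\<lambda>i. expansion E \<mu> w (A i)) ` {1..k}) | A.
            (\<forall>i\<in>{1..k}. A i \<noteq> {}) \<and> disjoint_family_on A {1..k}}"

text \<open>
  The minimum is over a finite set, although there are infinitely many functions \<open>A\<close>, and for
  \<open>1 \<le> k \<le> CARD('n)\<close> that set is nonempty.
\<close>

lemma finite_cheeger_values:
  fixes E :: "'n::finite set set" and k :: nat
  assumes "1 \<le> k"
  shows "finite {Max ((\<lambda>i. expansion E \<mu> w (A i)) ` {1..k}) | A.
            (\<forall>i\<in>{1..k}. A i \<noteq> {}) \<and> disjoint_family_on A {1..k}}"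
proof (rule finite_subset)
  show "{Max ((\<lambda>i. expansion E \<mu> w (A i)) ` {1..k}) | A.
            (\<forall>i\<in>{1..k}. A i \<noteq> {}) \<and> disjoint_family_on A {1..k}}
          \<subseteq> range (expansion E \<mu> w)"
  proof clarify
    fix A :: "nat \<Rightarrow> 'n set"
    have "Max ((\<lambda>i. expansion E \<mu> w (A i)) ` {1..k}) \<in> (\<lambda>i. expansion E \<mu> w (A i)) ` {1..k}"
      using assms by (intro Max_in) auto
    then show "Max ((\<lambda>i. expansion E \<mu> w (A i)) ` {1..k}) \<in> range (expansion E \<mu> w)"
      by blast
  qed
qed simp

text \<open>\<open>\<bar>x\<^sub>u - x\<^sub>v\<bar>\<close> as a function of the unordered pair \<open>{u, v}\<close>.\<close>

definition edge_diff :: "real ^ 'n::finite \<Rightarrow> 'n set \<Rightarrow> real" where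
  "edge_diff x e = (THE d. \<exists>u v. e = {u, v} \<and> d = \<bar>x $ u - x $ v\<bar>)"

lemma edge_diff_doubleton: "edge_diff x {u, v} = \<bar>x $ u - x $ v\<bar>"
  unfolding edge_diff_def by (rule the_equality) (auto simp: doubleton_eq_iff)

definition p_rayleigh ::
  "'n::finite set set \<Rightarrow> ('n \<Rightarrow> real) \<Rightarrow> ('n set \<Rightarrow> real) \<Rightarrow> real \<Rightarrow> real ^ 'n \<Rightarrow> real" where
  "p_rayleigh E \<mu> w p x =
     (\<Sum>e\<in>E. w e * edge_diff x e powr p) / (\<Sum>v\<in>UNIV. \<mu> v * \<bar>x $ v\<bar> powr p)"

text \<open>
  \<open>Euclidean_space m\<close> is \<open>\<real>\<^sup>m\<close>, realised as the functions \<open>nat \<Rightarrow> real\<close> vanishing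
  at all indices from \<open>m\<close> on.  For \<open>S = -S\<close> inside \<open>real ^ 'n\<close> without the origin the
  inclusion shows that some \<open>m \<le> CARD('n)\<close> qualifies, so \<open>LEAST\<close> is then a genuine minimum.
\<close>

definition genus :: "(real ^ 'n::finite) set \<Rightarrow> nat" where
  "genus S = (LEAST m. m > 0 \<and>
     (\<exists>f. continuous_map (top_of_set S) (Euclidean_space m) f \<and>
          (\<forall>x\<in>S. f x \<noteq> (\<lambda>i. 0)) \<and>
          (\<forall>x\<in>S. f (- x) = (\<lambda>i. - f x i))))"

text \<open>
  For \<open>p \<ge> 1\<close> and positive vertex weights the quotient is continuous away from the origin, so the
  supremum over a nonempty compact \<open>S\<close> is attained.
\<close>

definition minmax_eigenvalue ::
  "'n::finite set set \<Rightarrow> ('n \<Rightarrow> real) \<Rightarrow> ('n set \<Rightarrow> real) \<Rightarrow> real \<Rightarrow> nat \<Rightarrow> real" where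
  "minmax_eigenvalue E \<mu> w p k =
     (INF S \<in> {S. S \<noteq> {} \<and> compact S \<and> 0 \<notin> S \<and> uminus ` S = S \<and> genus S \<ge> k}.
        SUP x\<in>S. p_rayleigh E \<mu> w p x)"

end

theory Submission
  imports Defs "HOL-Homology.Invariance_of_Domain"
begin

text \<open>
  Both inequalities are proved by looking directly at the admissible sets \<open>S\<close>; eigenfunctions
  and their nodal domains never enter.

  Upper bound.  If \<open>A\<^sub>1, \<dots>, A\<^sub>k\<close> attain \<open>h\<^sub>k\<close>, the unit sphere of the span of their indicator
  functions is an admissible set.  Its genus is at least \<open>k\<close> by the Borsuk--Ulam theorem
  (\<open>Borsuk_Ulam_nsphere\<close>, \<open>genus_odd_sphere_image\<close>), and on it the Rayleigh quotient is at most
  \<open>2 powr (p - 1) * h\<^sub>k\<close>, because \<open>\<bar>a - b\<bar>\<^sup>p \<le> 2\<^sup>p\<^sup>-\<^sup>1 (\<bar>a\<bar>\<^sup>p + \<bar>b\<bar>\<^sup>p)\<close> on every edge that leaves some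
  \<open>A\<^sub>i\<close> (\<open>p_rayleigh_disjoint_span\<close>).

  Lower bound.  Put \<open>m = k - \<beta>\<close> and \<open>h = h\<^sub>m\<close>.  The key point is combinatorial
  (\<open>cheeger_hitting_set\<close>): at most \<open>k - 1\<close> vertices suffice to meet every nonempty set \<open>A\<close> with
  \<open>\<phi>(A) < h\<close>.  Indeed, \<open>\<beta>\<close> edges lie outside a spanning forest; let \<open>U\<close> contain one endpoint of
  each.  An inclusion-minimal set with \<open>\<phi> < h\<close> that avoids \<open>U\<close> is connected, hence a subtree of the
  forest.  No \<open>m\<close> of these subtrees are disjoint, by definition of \<open>h\<^sub>m\<close>, and for subtrees of a
  forest the maximal number of disjoint members equals the minimal number of vertices that meet
  all of them (\<open>subtree_packing_covering\<close>).  So at most \<open>m - 1\<close> vertices together with \<open>U\<close> do it.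
  If \<open>S\<close> has genus at least \<open>k\<close>, the coordinates at fewer than \<open>k\<close> vertices cannot define an odd
  map without zeros, so some \<open>x \<in> S\<close> vanishes on the hitting set
  (\<open>vanishing_point_if_genus_large\<close>).  Every nonempty set inside the support of \<open>x\<close> then
  satisfies \<open>\<phi> \<ge> h\<close>, and the coarea argument behind Cheeger's inequality bounds the Rayleigh
  quotient of \<open>x\<close> from below by \<open>2\<^sup>p\<^sup>-\<^sup>1 h\<^sup>p / p\<^sup>p\<close> (\<open>coarea\<close>, \<open>p_rayleigh_lower\<close>).
\<close>

section \<open>Odd maps of spheres have odd degree\<close>

lemma topspace_nsphere_iff:
  "x \<in> topspace (nsphere n) \<longleftrightarrow> (\<Sum>i\<le>n. (x i)\<^sup>2) = 1 \<and> (\<forall>i>n. x i = 0)"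
  by (simp add: nsphere)

lemma nsphere_eq_top_of_set: "nsphere n = top_of_set (topspace (nsphere n))"
proof -
  have "nsphere n = top_of_set {x. (\<Sum>i\<le>n. x i ^ 2) = 1 \<and> (\<forall>i>n. x i = 0)}"
    by (simp add: nsphere euclidean_product_topology)
  then show ?thesis
    by simp
qed

lemma continuous_map_nsphere_iff:
  "continuous_map (nsphere m) (nsphere n) f \<longleftrightarrow>
     continuous_on (topspace (nsphere m)) f \<and> f \<in> topspace (nsphere m) \<rightarrow> topspace (nsphere n)"
  by (subst (1 2) nsphere_eq_top_of_set) (rule continuous_map_subtopology_eu)

lemma uminus_in_nsphere:
  "x \<in> topspace (nsphere n) \<Longrightarrow> (\<lambda>i. - x i) \<in> topspace (nsphere n)"
  by (simp add: topspace_nsphere_iff)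

lemma nsphere_mono: "m \<le> n \<Longrightarrow> topspace (nsphere m) \<subseteq> topspace (nsphere n)"
proof
  fix x :: "nat \<Rightarrow> real" assume m: "m \<le> n" and x: "x \<in> topspace (nsphere m)"
  have "(\<Sum>i\<le>n. (x i)\<^sup>2) = (\<Sum>i\<le>m. (x i)\<^sup>2)"
    using m x by (intro sum.mono_neutral_right) (auto simp: topspace_nsphere_iff)
  then show "x \<in> topspace (nsphere n)"
    using m x by (auto simp: topspace_nsphere_iff)
qed

definition normalise :: "nat \<Rightarrow> (nat \<Rightarrow> real) \<Rightarrow> nat \<Rightarrow> real" where
  "normalise n x = (\<lambda>i. x i / sqrt (\<Sum>j\<le>n. (x j)\<^sup>2))"

lemma sum_squares_pos:
  fixes x :: "nat \<Rightarrow> real"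
  assumes "x \<noteq> (\<lambda>i. 0)" "\<forall>i>n. x i = 0"
  shows "(\<Sum>j\<le>n. (x j)\<^sup>2) > 0"
proof -
  obtain i where i: "x i \<noteq> 0" using assms(1) by auto
  then have "i \<le> n" using assms(2) by (metis not_le)
  then show ?thesis
    using i by (intro sum_pos2[of _ i]) auto
qed

lemma normalise_in_nsphere:
  assumes "x \<noteq> (\<lambda>i. 0)" "\<forall>i>n. x i = 0"
  shows "normalise n x \<in> topspace (nsphere n)"
  using sum_squares_pos[OF assms] assms(2)
  by (simp add: topspace_nsphere_iff normalise_def power_divide sum_divide_distrib[symmetric]
      sum_nonneg)

lemma normalise_nsphere: "x \<in> topspace (nsphere n) \<Longrightarrow> normalise n x = x"
  by (simp add: topspace_nsphere_iff normalise_def)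

lemma normalise_uminus: "normalise n (\<lambda>i. - x i) = (\<lambda>i. - normalise n x i)"
  by (simp add: normalise_def)

lemma continuous_on_coordinate:
  "continuous_on S f \<Longrightarrow> continuous_on S (\<lambda>x. f x (i::'i) :: 'b::topological_space)"
  by (rule continuous_on_compose2[OF continuous_on_product_coordinates]) auto

lemma continuous_on_normalise:
  assumes "continuous_on S f" "\<And>x. x \<in> S \<Longrightarrow> f x \<noteq> (\<lambda>i. 0)" "\<And>x i. x \<in> S \<Longrightarrow> i > n \<Longrightarrow> f x i = 0"
  shows "continuous_on S (\<lambda>x. normalise n (f x))"
  unfolding normalise_def
proof (rule continuous_on_coordinatewise_then_product)
  fix i
  have "sqrt (\<Sum>j\<le>n. (f x j)\<^sup>2) \<noteq> 0" if "x \<in> S" for x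
    using sum_squares_pos[of "f x" n] assms(2)[OF that] assms(3)[OF that] by simp
  then show "continuous_on S (\<lambda>x. f x i / sqrt (\<Sum>j\<le>n. (f x j)\<^sup>2))"
    by (intro continuous_intros continuous_on_coordinate[OF assms(1)]) auto
qed

text \<open>
  The segment from \<open>f x\<close> to \<open>g x\<close> misses the origin unless the two unit vectors are antipodal, so
  the straight-line homotopy can be pushed back to the sphere.
\<close>

lemma homotopic_nonantipodal:
  assumes f: "continuous_map (nsphere m) (nsphere n) f"
    and g: "continuous_map (nsphere m) (nsphere n) g"
    and fg: "\<And>x. x \<in> topspace (nsphere m) \<Longrightarrow> g x \<noteq> (\<lambda>i. - f x i)"
  shows "homotopic_with (\<lambda>x. True) (nsphere m) (nsphere n) f g"
proof -
  define S where "S = topspace (nsphere m)"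
  define h where "h = (\<lambda>(t::real, x). \<lambda>i. (1 - t) * f x i + t * g x i)"
  have fS: "continuous_on S f" "\<And>x. x \<in> S \<Longrightarrow> f x \<in> topspace (nsphere n)"
    using f by (auto simp: continuous_map_nsphere_iff S_def)
  have gS: "continuous_on S g" "\<And>x. x \<in> S \<Longrightarrow> g x \<in> topspace (nsphere n)"
    using g by (auto simp: continuous_map_nsphere_iff S_def)
  have nz: "h (t, x) \<noteq> (\<lambda>i. 0)" if t: "t \<in> {0..1}" and x: "x \<in> S" for t x
  proof
    assume "h (t, x) = (\<lambda>i. 0)"
    then have eq: "(1 - t) * f x i = - (t * g x i)" for i
      by (simp add: h_def fun_eq_iff add_eq_0_iff)
    have "(1 - t)\<^sup>2 * (\<Sum>i\<le>n. (f x i)\<^sup>2) = (\<Sum>i\<le>n. ((1 - t) * f x i)\<^sup>2)"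
      by (simp add: power_mult_distrib sum_distrib_left)
    also have "\<dots> = t\<^sup>2 * (\<Sum>i\<le>n. (g x i)\<^sup>2)"
      by (simp add: eq power_mult_distrib sum_distrib_left)
    finally have "(1 - t)\<^sup>2 = t\<^sup>2"
      using fS(2)[OF x] gS(2)[OF x] by (simp add: topspace_nsphere_iff)
    then have "1 - t = t"
      by (simp add: power2_eq_iff)
    then have t2: "t = 1/2"
      by simp
    have "g x i = - f x i" for i
      using eq[of i] unfolding t2 by simp
    then have "g x = (\<lambda>i. - f x i)"
      by (rule ext)
    then show False
      using fg x by (simp add: S_def)
  qed
  have top: "\<forall>i>n. h (t, x) i = 0" if x: "x \<in> S" for t x
    using fS(2)[OF x] gS(2)[OF x] by (simp add: h_def topspace_nsphere_iff)
  have "continuous_on ({0..1} \<times> S) h"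
    unfolding h_def case_prod_unfold
  proof (rule continuous_on_coordinatewise_then_product)
    fix i
    have "continuous_on ({0..1::real} \<times> S) (\<lambda>z. f (snd z))"
      by (rule continuous_on_compose2[OF fS(1)]) (auto intro: continuous_on_snd continuous_on_id)
    then have f': "continuous_on ({0..1::real} \<times> S) (\<lambda>z. f (snd z) i)"
      by (rule continuous_on_coordinate)
    have "continuous_on ({0..1::real} \<times> S) (\<lambda>z. g (snd z))"
      by (rule continuous_on_compose2[OF gS(1)]) (auto intro: continuous_on_snd continuous_on_id)
    then have g': "continuous_on ({0..1::real} \<times> S) (\<lambda>z. g (snd z) i)"
      by (rule continuous_on_coordinate)
    show "continuous_on ({0..1} \<times> S) (\<lambda>z. (1 - fst z) * f (snd z) i + fst z * g (snd z) i)"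
      by (intro continuous_intros f' g')
  qed
  then have "continuous_on ({0..1} \<times> S) (\<lambda>z. normalise n (h z))"
    using nz top by (intro continuous_on_normalise) auto
  moreover have "normalise n (h z) \<in> topspace (nsphere n)" if "z \<in> {0..1} \<times> S" for z
    using that nz top by (cases z) (auto intro!: normalise_in_nsphere)
  moreover have "normalise n (h (0, x)) = f x" "normalise n (h (1, x)) = g x" if "x \<in> S" for x
    using fS(2)[OF that] gS(2)[OF that] by (simp_all add: h_def normalise_nsphere)
  ultimately have "continuous_map (prod_topology (top_of_set {0..1}) (top_of_set S))
      (top_of_set (topspace (nsphere n))) (\<lambda>z. normalise n (h z)) \<and>
    (\<forall>x\<in>topspace (top_of_set S). normalise n (h (0, x)) = f x) \<and>
    (\<forall>x\<in>topspace (top_of_set S). normalise n (h (1, x)) = g x) \<and> (\<forall>t\<in>{0..1::real}. True)"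
    by (simp del: mem_Times_iff add: Pi_iff)
  then have "homotopic_with_canon (\<lambda>x. True) S (topspace (nsphere n)) f g"
    by (subst homotopic_with) (simp, rule exI)
  then show ?thesis
    unfolding S_def using nsphere_eq_top_of_set[of m] nsphere_eq_top_of_set[of n] by argo
qed

text \<open>
  \<open>R\<close> is the reflection in the hyperplane orthogonal to \<open>a - e\<close>.
\<close>

lemma nsphere_involution_mapping:
  assumes a: "a \<in> topspace (nsphere n)" and e: "e \<in> topspace (nsphere n)"
  obtains R where "continuous_map (nsphere n) (nsphere n) R"
    "\<And>x. R (R x) = x" "\<And>x. R (\<lambda>i. - x i) = (\<lambda>i. - R x i)" "R a = e"
proof -
  (* If a = e then D = 0, and division by zero makes R the identity, as wanted. *)
  define u where "u = (\<lambda>i. a i - e i)"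
  define D where "D = (\<Sum>j\<le>n. (u j)\<^sup>2)"
  define c where "c = (\<lambda>y. 2 * (\<Sum>j\<le>n. y j * u j) / D)"
  define R where "R = (\<lambda>y i. y i - c y * u i)"
  have u0: "u i = 0" if "i > n" for i
    using a e that by (simp add: u_def topspace_nsphere_iff)
  have "u i = 0" if "D = 0" for i
  proof (cases "i \<le> n")
    case True
    then show ?thesis
      using that by (simp add: D_def sum_nonneg_eq_0_iff)
  qed (simp add: u0)
  then have Dz: "a = e" if "D = 0"
    using that by (auto simp: u_def fun_eq_iff)
  have cD: "c y * D = 2 * (\<Sum>j\<le>n. y j * u j)" for y
  proof (cases "D = 0")
    case True
    then have "u j = 0" for j
      using Dz by (simp add: u_def)
    then show ?thesis
      by (simp add: True)
  qed (simp add: c_def)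
  have norm_R: "(\<Sum>i\<le>n. (R y i)\<^sup>2) = (\<Sum>i\<le>n. (y i)\<^sup>2)" for y
  proof -
    have "(\<Sum>i\<le>n. (R y i)\<^sup>2) = (\<Sum>i\<le>n. (y i)\<^sup>2 - 2 * c y * (y i * u i) + (c y)\<^sup>2 * (u i)\<^sup>2)"
      by (simp add: R_def power2_eq_square algebra_simps)
    also have "\<dots> = (\<Sum>i\<le>n. (y i)\<^sup>2) - 2 * c y * (\<Sum>i\<le>n. y i * u i) + (c y)\<^sup>2 * D"
      by (simp add: sum.distrib sum_subtractf sum_distrib_left D_def)
    also have "\<dots> = (\<Sum>i\<le>n. (y i)\<^sup>2) - c y * (2 * (\<Sum>i\<le>n. y i * u i) - c y * D)"
      by (simp add: power2_eq_square algebra_simps)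
    finally show ?thesis
      by (simp add: cD)
  qed
  have "(\<Sum>j\<le>n. R y j * u j) = (\<Sum>j\<le>n. y j * u j) - c y * D" for y
    by (simp add: R_def D_def power2_eq_square algebra_simps sum_subtractf sum_distrib_left)
  then have "(\<Sum>j\<le>n. R y j * u j) = - (\<Sum>j\<le>n. y j * u j)" for y
    by (simp add: cD)
  then have "c (R y) = - c y" for y
    by (simp add: c_def)
  then have "R (R y) = y" for y
    by (simp add: R_def)
  moreover have "R (\<lambda>i. - y i) = (\<lambda>i. - R y i)" for y
    by (simp add: R_def c_def sum_negf fun_eq_iff)
  moreover have "R a = e"
  proof (cases "D = 0")
    case True
    then show ?thesis
      using Dz by (auto simp: R_def u_def)
  next
    case False
    have "D = (\<Sum>j\<le>n. (a j)\<^sup>2 - 2 * (a j * e j) + (e j)\<^sup>2)"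
      by (simp add: D_def u_def power2_eq_square algebra_simps)
    also have "\<dots> = 2 * (1 - (\<Sum>j\<le>n. a j * e j))"
      using a e by (simp add: sum.distrib sum_subtractf topspace_nsphere_iff flip: sum_distrib_left)
    also have "1 - (\<Sum>j\<le>n. a j * e j) = (\<Sum>j\<le>n. (a j)\<^sup>2) - (\<Sum>j\<le>n. a j * e j)"
      using a by (simp add: topspace_nsphere_iff)
    also have "\<dots> = (\<Sum>j\<le>n. a j * u j)"
      by (simp add: u_def power2_eq_square algebra_simps sum_subtractf)
    finally have "c a = 1"
      using False by (simp add: c_def)
    then show ?thesis
      by (simp add: R_def u_def)
  qed
  moreover have "continuous_map (nsphere n) (nsphere n) R"
    unfolding continuous_map_nsphere_iff
  proof (intro conjI funcsetI)
    have coord: "continuous_on (topspace (nsphere n)) (\<lambda>y. y i :: real)" for i :: nat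
      by (rule continuous_on_coordinate) (rule continuous_on_id)
    show "continuous_on (topspace (nsphere n)) R"
      unfolding R_def c_def divide_inverse
      by (intro continuous_on_coordinatewise_then_product continuous_on_diff continuous_on_mult
          continuous_on_sum continuous_on_const coord)
    fix y assume "y \<in> topspace (nsphere n)"
    then show "R y \<in> topspace (nsphere n)"
      using norm_R[of y] u0 by (simp add: topspace_nsphere_iff) (simp add: R_def)
  qed
  ultimately show thesis
    using that by blast
qed

text \<open>
  If the image of the equator avoids both poles, the last coordinate of \<open>f\<close> can be multiplied by
  the factor \<open>x\<^sub>n\<^sub>+\<^sub>1\<^sup>2\<close>.  The factor is even in \<open>x\<close>, so oddness survives; it vanishes only on the equator,
  where another coordinate of \<open>f\<close> is nonzero, so nothing becomes zero; and the equator is then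
  mapped to itself.
\<close>

lemma equator_preserving_deformation:
  fixes f :: "(nat \<Rightarrow> real) \<Rightarrow> nat \<Rightarrow> real"
  assumes f: "continuous_map (nsphere (Suc n)) (nsphere (Suc n)) f"
    and odd: "\<And>x. x \<in> topspace (nsphere (Suc n)) \<Longrightarrow> f (\<lambda>i. - x i) = (\<lambda>i. - f x i)"
    and pole: "\<And>x. x \<in> topspace (nsphere n) \<Longrightarrow> \<exists>i\<le>n. f x i \<noteq> 0"
  obtains h where "continuous_map (nsphere (Suc n)) (nsphere (Suc n)) h"
    "\<And>x. x \<in> topspace (nsphere (Suc n)) \<Longrightarrow> h (\<lambda>i. - x i) = (\<lambda>i. - h x i)"
    "h \<in> topspace (nsphere n) \<rightarrow> topspace (nsphere n)"
    "Brouwer_degree2 (Suc n) h = Brouwer_degree2 (Suc n) f"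
proof -
  define S where "S = topspace (nsphere (Suc n))"
  define k where "k = (\<lambda>x i. if i = Suc n then (x (Suc n))\<^sup>2 * f x i else f x i)"
  define h where "h = (\<lambda>x. normalise (Suc n) (k x))"
  have fS: "continuous_on S f" "\<And>x. x \<in> S \<Longrightarrow> f x \<in> S"
    using f by (auto simp: continuous_map_nsphere_iff S_def)
  have low: "\<exists>i\<le>n. f x i \<noteq> 0" if x: "x \<in> S" "x (Suc n) = 0" for x
    using topspace_nsphere_minus1[of x "Suc n"] pole x by (simp add: S_def)
  have pos: "(\<Sum>i\<le>Suc n. k x i * f x i) > 0" if x: "x \<in> S" for x
  proof -
    (* A positive inner product keeps the normalised k x away from - f x. *)
    have nonneg: "0 \<le> k x i * f x i" for i
      by (cases "i = Suc n") (simp_all add: k_def mult.assoc)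
    show ?thesis
    proof (cases "\<exists>i\<le>n. f x i \<noteq> 0")
    case True
    then obtain j where "j \<le> n" "f x j \<noteq> 0"
      by blast
    then show ?thesis
      using nonneg by (intro sum_pos2[of _ j]) (auto simp: k_def simp flip: power2_eq_square)
  next
    case False
    then have "x (Suc n) \<noteq> 0"
      using low[OF x] by blast
    moreover have "f x (Suc n) \<noteq> 0"
      using False fS(2)[OF x] by (auto simp: S_def topspace_nsphere_iff)
    ultimately show ?thesis
      using nonneg by (intro sum_pos2[of _ "Suc n"]) (auto simp: k_def mult.assoc zero_less_mult_iff)
    qed
  qed
  have nz: "k x \<noteq> (\<lambda>i. 0)" if "x \<in> S" for x
    using pos[OF that] by auto
  have top: "k x i = 0" if "x \<in> S" "i > Suc n" for x i
    using fS(2)[OF that(1)] that(2) by (simp add: k_def S_def topspace_nsphere_iff)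
  have fi: "continuous_on S (\<lambda>x. f x i)" for i
    using fS(1) by (rule continuous_on_coordinate)
  have xi: "continuous_on S (\<lambda>x. x i :: real)" for i :: nat
    by (rule continuous_on_coordinate) (rule continuous_on_id)
  have "continuous_on S k"
  proof (rule continuous_on_coordinatewise_then_product)
    fix i
    show "continuous_on S (\<lambda>x. k x i)"
      by (cases "i = Suc n") (simp_all add: k_def fi continuous_on_mult continuous_on_power xi)
  qed
  then have "continuous_on S h"
    unfolding h_def using nz top by (rule continuous_on_normalise)
  moreover have hS: "h x \<in> S" if "x \<in> S" for x
    unfolding h_def S_def using nz[OF that] top[OF that] by (intro normalise_in_nsphere) auto
  ultimately have h: "continuous_map (nsphere (Suc n)) (nsphere (Suc n)) h"
    by (auto simp: continuous_map_nsphere_iff S_def)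
  moreover have "h (\<lambda>i. - x i) = (\<lambda>i. - h x i)" if "x \<in> topspace (nsphere (Suc n))" for x
  proof -
    have "k (\<lambda>i. - x i) = (\<lambda>i. - k x i)"
      using odd[OF that] by (simp add: k_def fun_eq_iff)
    then show ?thesis
      by (simp add: h_def normalise_uminus)
  qed
  moreover have "h \<in> topspace (nsphere n) \<rightarrow> topspace (nsphere n)"
  proof
    fix x assume x: "x \<in> topspace (nsphere n)"
    then have "x \<in> S" "x (Suc n) = 0"
      using nsphere_mono[of n "Suc n"] by (auto simp: S_def topspace_nsphere_iff)
    then have "h x \<in> topspace (nsphere (Suc n))"
      using hS[of x] unfolding S_def by simp
    moreover have "h x (Suc n) = 0"
      using \<open>x (Suc n) = 0\<close> by (simp add: h_def normalise_def k_def)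
    ultimately have "h x \<in> topspace (nsphere (Suc n - Suc 0))"
      by (rule topspace_nsphere_minus1)
    then show "h x \<in> topspace (nsphere n)"
      by simp
  qed
  moreover have "h x \<noteq> (\<lambda>i. - f x i)" if x: "x \<in> S" for x
  proof
    assume eq: "h x = (\<lambda>i. - f x i)"
    define s where "s = sqrt (\<Sum>j\<le>Suc n. (k x j)\<^sup>2)"
    have "s > 0"
      using sum_squares_pos[of "k x" "Suc n"] nz[OF x] top[OF x] by (auto simp: s_def)
    have "k x i / s = - f x i" for i
      using fun_cong[OF eq, of i] unfolding h_def normalise_def s_def .
    with \<open>s > 0\<close> have "k x i = - s * f x i" for i
      by (simp add: divide_eq_eq mult.commute)
    then have "(\<Sum>i\<le>Suc n. k x i * f x i) = - s * (\<Sum>i\<le>Suc n. f x i * f x i)"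
      by (simp only: sum_distrib_left mult.assoc)
    also have "\<dots> \<le> 0"
      using \<open>s > 0\<close> by (simp add: sum_nonneg mult_nonneg_nonneg del: sum.atMost_Suc)
    finally show False
      using pos[OF x] by linarith
  qed
  then have "Brouwer_degree2 (Suc n) h = Brouwer_degree2 (Suc n) f"
    using Brouwer_degree2_homotopic[OF homotopic_nonantipodal[OF f h]] by (simp add: S_def)
  ultimately show thesis
    by (rule that)
qed

text \<open>
  A continuous image of the equator may fill the whole sphere, but a smooth one cannot.  An odd
  polynomial approximation, normalised, is a smooth odd map; it is close enough to \<open>f\<close> to have the same
  degree, and oddness shows that it avoids \<open>- a\<close> whenever it avoids \<open>a\<close>.  Polynomials and the
  dimension argument live in a Euclidean space, to which the sphere is transported by the
  linear isometry \<open>\<iota>\<close>; the type \<open>'a\<close> provides one of sufficient dimension.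
\<close>

lemma odd_sphere_map_missing_direction:
  fixes f :: "(nat \<Rightarrow> real) \<Rightarrow> nat \<Rightarrow> real"
  assumes dim: "Suc n < DIM('a::euclidean_space)"
    and f: "continuous_map (nsphere (Suc n)) (nsphere (Suc n)) f"
    and odd: "\<And>x. x \<in> topspace (nsphere (Suc n)) \<Longrightarrow> f (\<lambda>i. - x i) = (\<lambda>i. - f x i)"
  obtains g a where "continuous_map (nsphere (Suc n)) (nsphere (Suc n)) g"
    "\<And>x. x \<in> topspace (nsphere (Suc n)) \<Longrightarrow> g (\<lambda>i. - x i) = (\<lambda>i. - g x i)"
    "Brouwer_degree2 (Suc n) g = Brouwer_degree2 (Suc n) f"
    "a \<in> topspace (nsphere (Suc n))"
    "\<And>x. x \<in> topspace (nsphere n) \<Longrightarrow> g x \<noteq> a \<and> g x \<noteq> (\<lambda>i. - a i)"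
proof -
  define D where "D = DIM('a)"
  obtain b :: "nat \<Rightarrow> 'a" where "bij_betw b {0..<card (Basis :: 'a set)} Basis"
    using ex_bij_betw_nat_finite[OF finite_Basis] by blast
  then have b: "bij_betw b {..<D} Basis"
    by (simp add: D_def atLeast0LessThan)
  define \<iota> :: "(nat \<Rightarrow> real) \<Rightarrow> 'a" where "\<iota> = (\<lambda>x. \<Sum>i<D. x i *\<^sub>R b i)"
  define \<kappa> :: "'a \<Rightarrow> nat \<Rightarrow> real" where "\<kappa> = (\<lambda>y i. if i < D then y \<bullet> b i else 0)"
  define T :: "nat \<Rightarrow> 'a set" where "T = (\<lambda>m. {y. \<forall>u\<in>Basis. u \<notin> b ` {..<m} \<longrightarrow> y \<bullet> u = 0})"
  have basis: "b i \<in> Basis" if "i < D" for i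
    using b that by (auto simp: bij_betw_def)
  have inj: "b i = b j \<longleftrightarrow> i = j" if "i < D" "j < D" for i j
    using b that by (auto simp: bij_betw_def inj_on_def)
  have T_iff: "y \<in> T m \<longleftrightarrow> (\<forall>i<D. m \<le> i \<longrightarrow> y \<bullet> b i = 0)" if "m \<le> D" for m y
  proof
    assume "y \<in> T m"
    then show "\<forall>i<D. m \<le> i \<longrightarrow> y \<bullet> b i = 0"
      using basis inj that by (auto simp: T_def image_iff)
  next
    assume *: "\<forall>i<D. m \<le> i \<longrightarrow> y \<bullet> b i = 0"
    show "y \<in> T m"
      unfolding T_def
    proof clarify
      fix u :: 'a assume "u \<in> Basis" "u \<notin> b ` {..<m}"
      moreover then obtain i where "i < D" "u = b i"
        using b by (auto simp: bij_betw_def)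
      ultimately show "y \<bullet> u = 0"
        using * by (auto simp: not_le)
    qed
  qed
  have subT: "subspace (T m)" for m
    by (auto simp: T_def subspace_def inner_add_left)
  have dimT: "dim (T m) = m" if "m \<le> D" for m
  proof -
    have "dim (T m) = card (b ` {..<m})"
      unfolding T_def using basis that by (intro dim_substandard) auto
    also have "\<dots> = m"
      using b that by (subst card_image) (auto simp: bij_betw_def inj_on_def)
    finally show ?thesis .
  qed
  have \<iota>_inner: "\<iota> x \<bullet> b j = x j" if "j < D" for x j
  proof -
    have "\<iota> x \<bullet> b j = (\<Sum>i<D. x i * (b i \<bullet> b j))"
      by (simp add: \<iota>_def inner_sum_left)
    also have "\<dots> = (\<Sum>i<D. if i = j then x i else 0)"
      using basis inj that by (intro sum.cong) (auto simp: inner_Basis)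
    finally show ?thesis
      using that by simp
  qed
  have \<kappa>\<iota>: "\<kappa> (\<iota> x) = x" if "\<And>i. i \<ge> D \<Longrightarrow> x i = 0" for x
    using that \<iota>_inner by (auto simp: \<kappa>_def fun_eq_iff)
  have \<iota>\<kappa>: "\<iota> (\<kappa> y) = y" for y
  proof -
    have "\<iota> (\<kappa> y) = (\<Sum>i<D. (y \<bullet> b i) *\<^sub>R b i)"
      by (simp add: \<iota>_def \<kappa>_def)
    also have "\<dots> = (\<Sum>u\<in>Basis. (y \<bullet> u) *\<^sub>R u)"
      by (rule sum.reindex_bij_betw[OF b])
    finally show ?thesis
      by (simp add: euclidean_representation)
  qed
  have norm_D: "(norm y)\<^sup>2 = (\<Sum>i<D. (y \<bullet> b i)\<^sup>2)" for y
  proof -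
    have "(norm y)\<^sup>2 = (\<Sum>u\<in>Basis. (y \<bullet> u)\<^sup>2)"
      unfolding power2_norm_eq_inner by (subst euclidean_inner) (simp add: power2_eq_square)
    also have "\<dots> = (\<Sum>i<D. (y \<bullet> b i)\<^sup>2)"
      by (rule sum.reindex_bij_betw[OF b, symmetric])
    finally show ?thesis .
  qed
  have \<kappa>_sphere: "\<kappa> y \<in> topspace (nsphere m)" if m: "m < D" and y: "y \<in> sphere 0 1 \<inter> T (Suc m)" for m y
  proof -
    have zero: "y \<bullet> b i = 0" if "i < D" "m < i" for i
      using y T_iff[of "Suc m" y] m that by auto
    have "(\<Sum>i\<le>m. (\<kappa> y i)\<^sup>2) = (\<Sum>i\<le>m. (y \<bullet> b i)\<^sup>2)"
      using m by (intro sum.cong) (auto simp: \<kappa>_def)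
    also have "\<dots> = (norm y)\<^sup>2"
      unfolding norm_D using m zero by (intro sum.mono_neutral_left) auto
    finally show ?thesis
      using y zero by (auto simp: topspace_nsphere_iff \<kappa>_def)
  qed
  have \<iota>_sphere: "\<iota> x \<in> sphere 0 1 \<inter> T (Suc m)" if m: "m < D" and x: "x \<in> topspace (nsphere m)" for m x
  proof -
    have "\<iota> x \<in> T (Suc m)"
      using x m by (simp add: T_iff \<iota>_inner topspace_nsphere_iff)
    have "(norm (\<iota> x))\<^sup>2 = (\<Sum>i<D. (x i)\<^sup>2)"
      by (simp add: norm_D \<iota>_inner)
    also have "\<dots> = (\<Sum>i\<le>m. (x i)\<^sup>2)"
      using x m by (intro sum.mono_neutral_right) (auto simp: topspace_nsphere_iff)
    finally have "norm (\<iota> x) = 1"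
      using x by (simp add: topspace_nsphere_iff power2_eq_1_iff)
        (metis norm_ge_zero neg_0_le_iff_le not_one_le_zero)
    with \<open>\<iota> x \<in> T (Suc m)\<close> show ?thesis
      by simp
  qed
  have \<kappa>\<iota>': "\<kappa> (\<iota> x) = x" if "x \<in> topspace (nsphere (Suc n))" for x
    using that dim by (intro \<kappa>\<iota>) (auto simp: topspace_nsphere_iff D_def)
  have \<iota>_minus: "\<iota> (\<lambda>i. - x i) = - \<iota> x" for x
    by (simp add: \<iota>_def sum_negf)
  have \<kappa>_minus: "\<kappa> (- y) = (\<lambda>i. - \<kappa> y i)" for y
    by (auto simp: \<kappa>_def)
  have cont_\<iota>: "continuous_on A \<iota>" for A
    unfolding \<iota>_def by (intro continuous_intros continuous_on_coordinate[OF continuous_on_id])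
  have cont_\<kappa>: "continuous_on A \<kappa>" for A
    unfolding \<kappa>_def
  proof (rule continuous_on_coordinatewise_then_product)
    show "continuous_on A (\<lambda>y. if i < D then y \<bullet> b i else 0)" for i
      by (cases "i < D") (auto intro!: continuous_intros)
  qed
  define S where "S = topspace (nsphere (Suc n))"
  define K where "K = sphere 0 1 \<inter> T (Suc (Suc n))"
  have fS: "continuous_on S f" "\<And>x. x \<in> S \<Longrightarrow> f x \<in> S"
    using f by (auto simp: continuous_map_nsphere_iff S_def)
  have \<kappa>K: "\<kappa> y \<in> S" if "y \<in> K" for y
    using \<kappa>_sphere[of "Suc n" y] that dim by (simp add: S_def K_def D_def)
  have \<iota>S: "\<iota> x \<in> K" if "x \<in> S" for x
    using \<iota>_sphere[of "Suc n" x] that dim by (simp add: S_def K_def D_def)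
  have K_minus: "- y \<in> K" if "y \<in> K" for y
    using that subspace_neg[OF subT] by (auto simp: K_def)
  define F where "F = (\<lambda>y. \<iota> (f (\<kappa> y)))"
  have "continuous_on K F"
    unfolding F_def
    by (intro continuous_on_compose2[OF cont_\<iota>[of UNIV]] continuous_on_compose2[OF fS(1)] cont_\<kappa>)
       (auto simp: \<kappa>K)
  have FK: "F y \<in> K" if "y \<in> K" for y
    using that by (simp add: F_def \<kappa>K \<iota>S fS(2))
  have F_odd: "F (- y) = - F y" if "y \<in> K" for y
    using odd[of "\<kappa> y"] \<kappa>K[OF that] by (simp add: F_def \<kappa>_minus \<iota>_minus S_def)
  have "compact K"
    unfolding K_def by (intro compact_Int_closed closed_subspace subT) auto
  obtain q where q: "polynomial_function q" "q ` K \<subseteq> T (Suc (Suc n))"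
    and qF: "\<And>y. y \<in> K \<Longrightarrow> norm (F y - q y) < 1"
  proof (rule Stone_Weierstrass_polynomial_function_subspace
      [OF \<open>compact K\<close> \<open>continuous_on K F\<close> zero_less_one subT[of "Suc (Suc n)"]])
    show "F ` K \<subseteq> T (Suc (Suc n))"
      using FK by (auto simp: K_def)
  qed blast
  (* The odd part of q approximates F as well as q does, since F is odd. *)
  define r where "r = (\<lambda>y. (1/2) *\<^sub>R (q y - q (- y)))"
  have "polynomial_function r"
    unfolding r_def
    by (intro polynomial_function_cmul polynomial_function_diff q(1)
        polynomial_function_compose[OF _ q(1), unfolded o_def] polynomial_function_minus
        polynomial_function_id)
  have rT: "r y \<in> T (Suc (Suc n))" if "y \<in> K" for y
    unfolding r_def using q(2) that K_minus[OF that]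
    by (intro subspace_scale subspace_diff subT) auto
  have r_odd: "r (- y) = - r y" for y
    by (simp add: r_def algebra_simps)
  have rF: "norm (F y - r y) < 1" if "y \<in> K" for y
  proof -
    have "F y - r y = (1/2) *\<^sub>R ((F y - q y) - (F (- y) - q (- y)))"
      by (simp add: r_def F_odd that algebra_simps flip: scaleR_add_left)
    also have "norm \<dots> \<le> (1/2) * (norm (F y - q y) + norm (F (- y) - q (- y)))"
      using norm_triangle_ineq4[of "F y - q y" "F (- y) - q (- y)"] by simp
    finally show ?thesis
      using qF[OF that] qF[OF K_minus[OF that]] by simp
  qed
  have rnz: "r y \<noteq> 0" if "y \<in> K" for y
    using rF[OF that] FK[OF that] by (auto simp: K_def)
  define G where "G = (\<lambda>y. r y /\<^sub>R norm (r y))"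
  have GK: "G y \<in> K" if "y \<in> K" for y
    using rnz[OF that] subspace_scale[OF subT rT[OF that]] by (simp add: G_def K_def)
  have G_diff: "G differentiable_on K"
  proof -
    have r: "r differentiable_on K"
      by (rule differentiable_on_polynomial_function) fact
    then have "(\<lambda>y. inverse (norm (r y))) differentiable_on K"
      using rnz by (intro differentiable_on_inverse differentiable_on_compose[OF r] differentiable_on_norm) auto
    then show ?thesis
      unfolding G_def using r by (intro differentiable_on_scaleR)
  qed
  have "G ` (sphere 0 1 \<inter> T (Suc n)) \<noteq> K"
    unfolding K_def
  proof (rule spheremap_lemma1)
    show "dim (T (Suc n)) < dim (T (Suc (Suc n)))"
      using dim by (simp add: dimT D_def)
    show "T (Suc n) \<subseteq> T (Suc (Suc n))"
      by (auto simp: T_def)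
    then show "G differentiable_on sphere 0 1 \<inter> T (Suc n)"
      by (intro differentiable_on_subset[OF G_diff]) (auto simp: K_def)
  qed (rule subT)+
  moreover have TK: "sphere 0 1 \<inter> T (Suc n) \<subseteq> K"
    by (auto simp: K_def T_def)
  ultimately obtain d where d: "d \<in> K" "d \<notin> G ` (sphere 0 1 \<inter> T (Suc n))"
    using GK by blast
  define g where "g = (\<lambda>x. \<kappa> (G (\<iota> x)))"
  have g: "continuous_map (nsphere (Suc n)) (nsphere (Suc n)) g"
    unfolding continuous_map_nsphere_iff S_def[symmetric]
  proof (intro conjI funcsetI)
    show "continuous_on S g"
      unfolding g_def
      by (intro continuous_on_compose2[OF cont_\<kappa>[of UNIV]] cont_\<iota>
          continuous_on_compose2[OF differentiable_imp_continuous_on[OF G_diff]]) (auto simp: \<iota>S)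
  qed (simp add: g_def \<kappa>K GK \<iota>S)
  moreover have "g (\<lambda>i. - x i) = (\<lambda>i. - g x i)" for x
    by (simp add: g_def \<iota>_minus G_def r_odd flip: \<kappa>_minus)
  moreover have "g x \<noteq> (\<lambda>i. - f x i)" if x: "x \<in> topspace (nsphere (Suc n))" for x
  proof
    assume "g x = (\<lambda>i. - f x i)"
    then have "\<iota> (g x) = - \<iota> (f x)"
      by (simp add: \<iota>_minus)
    then have "G (\<iota> x) = - F (\<iota> x)"
      using x by (simp add: g_def \<iota>\<kappa> F_def \<kappa>\<iota>')
    moreover have y: "\<iota> x \<in> K"
      using x \<iota>S by (simp add: S_def)
    moreover have "r (\<iota> x) = norm (r (\<iota> x)) *\<^sub>R G (\<iota> x)"
      using rnz[OF y] by (simp add: G_def)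
    ultimately have "r (\<iota> x) = norm (r (\<iota> x)) *\<^sub>R - F (\<iota> x)"
      by simp
    then have "F (\<iota> x) - r (\<iota> x) = F (\<iota> x) - norm (r (\<iota> x)) *\<^sub>R - F (\<iota> x)"
      by (rule arg_cong)
    also have "\<dots> = (1 + norm (r (\<iota> x))) *\<^sub>R F (\<iota> x)"
      by (simp add: scaleR_add_left)
    finally have "F (\<iota> x) - r (\<iota> x) = (1 + norm (r (\<iota> x))) *\<^sub>R F (\<iota> x)" .
    then have "norm (F (\<iota> x) - r (\<iota> x)) = 1 + norm (r (\<iota> x))"
      using FK[OF y] by (simp add: K_def)
    then show False
      using rF[OF y] by simp
  qed
  then have "Brouwer_degree2 (Suc n) g = Brouwer_degree2 (Suc n) f"
    using Brouwer_degree2_homotopic[OF homotopic_nonantipodal[OF f g]] by simp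
  moreover have "\<kappa> d \<in> topspace (nsphere (Suc n))"
    using \<kappa>K d(1) by (simp add: S_def)
  moreover have "g x \<noteq> \<kappa> d \<and> g x \<noteq> (\<lambda>i. - \<kappa> d i)" if x: "x \<in> topspace (nsphere n)" for x
  proof -
    have y: "\<iota> x \<in> sphere 0 1 \<inter> T (Suc n)"
      using \<iota>_sphere[of n x] x dim by (simp add: D_def)
    moreover then have "- \<iota> x \<in> sphere 0 1 \<inter> T (Suc n)"
      using subspace_neg[OF subT] by auto
    ultimately have "G (\<iota> x) \<noteq> d" "G (- \<iota> x) \<noteq> d"
      using d(2) by blast+
    then have "G (\<iota> x) \<noteq> d" "G (\<iota> x) \<noteq> - d"
      by (auto simp: G_def r_odd)
    moreover have "\<iota> (g x) = G (\<iota> x)"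
      by (simp add: g_def \<iota>\<kappa>)
    ultimately show ?thesis
      by (metis \<iota>\<kappa> \<iota>_minus)
  qed
  ultimately show thesis
    by (intro that[of g "\<kappa> d"]) auto
qed

text \<open>
  By induction on the dimension, since an odd map that preserves the equator has the same degree
  modulo 2 as its restriction to the equator.  A general odd map is first deformed so that the
  image of the equator avoids two antipodal points; a reflection moves these to the poles; and then
  \<open>equator_preserving_deformation\<close> applies.  The reflection multiplies the degree by an integer, so
  the original degree is odd once the product is.
\<close>

theorem Borsuk_odd_mapping_degree:
  fixes f :: "(nat \<Rightarrow> real) \<Rightarrow> nat \<Rightarrow> real"
  assumes "n < DIM('a::euclidean_space)"
    and "continuous_map (nsphere n) (nsphere n) f"
    and "\<And>x. x \<in> topspace (nsphere n) \<Longrightarrow> f (\<lambda>i. - x i) = (\<lambda>i. - f x i)"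
  shows "odd (Brouwer_degree2 n f)"
  using assms
proof (induction n arbitrary: f)
  case 0
  have pm: "x 0 = 1 \<or> x 0 = - 1" "\<And>i. i > 0 \<Longrightarrow> x i = 0" if "x \<in> topspace (nsphere 0)" for x
    using that by (auto simp: topspace_nsphere_iff power2_eq_1_iff)
  define e :: "nat \<Rightarrow> real" where "e = (\<lambda>i. if i = 0 then 1 else 0)"
  have e: "e \<in> topspace (nsphere 0)"
    by (simp add: e_def in_topspace_nsphere)
  have cases: "x = e \<or> x = (\<lambda>i. - e i)" if "x \<in> topspace (nsphere 0)" for x
    using pm[OF that] by (auto simp: e_def fun_eq_iff)
  have "f e \<in> topspace (nsphere 0)"
    using "0.prems"(2) e by (auto simp: continuous_map_nsphere_iff)
  then consider "f e = e" | "f e = (\<lambda>i. - e i)"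
    using cases by blast
  then show ?case
  proof cases
    case 1
    then have "f x = id x" if "x \<in> topspace (nsphere 0)" for x
      using cases[OF that] "0.prems"(3)[OF e] by auto
    then have "Brouwer_degree2 0 f = Brouwer_degree2 0 id"
      by (rule Brouwer_degree2_eq)
    then show ?thesis
      by simp
  next
    case 2
    have "f x = (\<lambda>i. if i = 0 then - x i else x i)" if x: "x \<in> topspace (nsphere 0)" for x
    proof -
      have "f x = (\<lambda>i. - x i)"
        using cases[OF x] "0.prems"(3)[OF e] 2 by auto
      then show ?thesis
        using pm(2)[OF x] by (simp add: fun_eq_iff)
    qed
    then have "Brouwer_degree2 0 f = Brouwer_degree2 0 (\<lambda>x i. if i = 0 then - x i else x i)"
      by (rule Brouwer_degree2_eq)
    then show ?thesis
      using Brouwer_degree2_reflection[of 0] by simp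
  qed
next
  case (Suc n)
  obtain g a where g: "continuous_map (nsphere (Suc n)) (nsphere (Suc n)) g"
    "\<And>x. x \<in> topspace (nsphere (Suc n)) \<Longrightarrow> g (\<lambda>i. - x i) = (\<lambda>i. - g x i)"
    "Brouwer_degree2 (Suc n) g = Brouwer_degree2 (Suc n) f"
    and a: "a \<in> topspace (nsphere (Suc n))"
    "\<And>x. x \<in> topspace (nsphere n) \<Longrightarrow> g x \<noteq> a \<and> g x \<noteq> (\<lambda>i. - a i)"
  proof (rule odd_sphere_map_missing_direction[OF Suc.prems(1,2)])
    show "f (\<lambda>i. - x i) = (\<lambda>i. - f x i)" if "x \<in> topspace (nsphere (Suc n))" for x
      using that by (rule Suc.prems(3))
  qed (rule that)
  define e :: "nat \<Rightarrow> real" where "e = (\<lambda>i. if i = Suc n then 1 else 0)"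
  have "e \<in> topspace (nsphere (Suc n))"
    by (simp add: topspace_nsphere_iff e_def)
  then obtain R where R: "continuous_map (nsphere (Suc n)) (nsphere (Suc n)) R"
    "\<And>x. R (R x) = x" "\<And>x. R (\<lambda>i. - x i) = (\<lambda>i. - R x i)" "R a = e"
    by (rule nsphere_involution_mapping[OF a(1)]) (rule that)
  have Rg: "continuous_map (nsphere (Suc n)) (nsphere (Suc n)) (R \<circ> g)"
    using continuous_map_compose[OF g(1) R(1)] .
  have Rg_odd: "(R \<circ> g) (\<lambda>i. - x i) = (\<lambda>i. - (R \<circ> g) x i)" if "x \<in> topspace (nsphere (Suc n))" for x
    using g(2)[OF that] R(3) by simp
  have pole: "\<exists>i\<le>n. (R \<circ> g) x i \<noteq> 0" if x: "x \<in> topspace (nsphere n)" for x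
  proof (rule ccontr)
    assume *: "\<not> (\<exists>i\<le>n. (R \<circ> g) x i \<noteq> 0)"
    have "x \<in> topspace (nsphere (Suc n))"
      using x nsphere_mono[of n "Suc n"] by auto
    then have "(R \<circ> g) x \<in> topspace (nsphere (Suc n))"
      using Rg by (auto simp: continuous_map_nsphere_iff)
    then have "((R \<circ> g) x (Suc n))\<^sup>2 = 1" "\<And>i. i > Suc n \<Longrightarrow> (R \<circ> g) x i = 0"
      using * by (auto simp: topspace_nsphere_iff)
    then have "R (g x) = e \<or> R (g x) = (\<lambda>i. - e i)"
      using * by (auto simp: e_def fun_eq_iff power2_eq_1_iff) (metis not_less_eq_eq le_neq_implies_less)+
    then have "g x = a \<or> g x = (\<lambda>i. - a i)"
      by (metis R(2,3,4))
    then show False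
      using a(2)[OF x] by blast
  qed
  obtain h where h: "continuous_map (nsphere (Suc n)) (nsphere (Suc n)) h"
    "\<And>x. x \<in> topspace (nsphere (Suc n)) \<Longrightarrow> h (\<lambda>i. - x i) = (\<lambda>i. - h x i)"
    "h \<in> topspace (nsphere n) \<rightarrow> topspace (nsphere n)"
    "Brouwer_degree2 (Suc n) h = Brouwer_degree2 (Suc n) (R \<circ> g)"
  proof (rule equator_preserving_deformation[OF Rg])
    show "(R \<circ> g) (\<lambda>i. - x i) = (\<lambda>i. - (R \<circ> g) x i)" if "x \<in> topspace (nsphere (Suc n))" for x
      using that by (rule Rg_odd)
    show "\<exists>i\<le>n. (R \<circ> g) x i \<noteq> 0" if "x \<in> topspace (nsphere n)" for x
      using that by (rule pole)
  qed (rule that)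
  have sub: "topspace (nsphere n) \<subseteq> topspace (nsphere (Suc n))"
    by (rule nsphere_mono) simp
  have "continuous_map (nsphere n) (nsphere n) h"
    using h(1,3) continuous_on_subset[OF _ sub] by (auto simp: continuous_map_nsphere_iff)
  then have "odd (Brouwer_degree2 n h)"
    using Suc.prems(1) h(2) sub by (intro Suc.IH) auto
  moreover have "even (Brouwer_degree2 (Suc n) h - Brouwer_degree2 n h)"
    using Borsuk_odd_mapping_degree_step[OF h(1)] h(2,3) by (simp add: o_def)
  ultimately have "odd (Brouwer_degree2 (Suc n) (R \<circ> g))"
    using h(4) by auto
  then show ?case
    using Brouwer_degree2_compose[OF g(1) R(1)] g(3) by simp
qed

text \<open>
  Without a zero, \<open>f\<close> could be normalised to an odd map of the \<open>n\<close>-sphere into a proper subsphere.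
  Such a map is not surjective, so its degree would be 0.
\<close>

corollary Borsuk_Ulam_nsphere:
  fixes f :: "(nat \<Rightarrow> real) \<Rightarrow> nat \<Rightarrow> real"
  assumes n: "n < DIM('a::euclidean_space)" and m: "m \<le> n"
    and f: "continuous_map (nsphere n) (Euclidean_space m) f"
    and odd: "\<And>x. x \<in> topspace (nsphere n) \<Longrightarrow> f (\<lambda>i. - x i) = (\<lambda>i. - f x i)"
  shows "\<exists>x\<in>topspace (nsphere n). f x = (\<lambda>i. 0)"
proof (rule ccontr)
  assume "\<not> ?thesis"
  then have nz: "f x \<noteq> (\<lambda>i. 0)" if "x \<in> topspace (nsphere n)" for x
    using that by blast
  have "continuous_map (nsphere n) (top_of_set {x. \<forall>i\<ge>m. x i = 0}) f"
    using f by (simp add: Euclidean_space_def euclidean_product_topology)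
  then have fc: "continuous_on (topspace (nsphere n)) f"
    and ft: "\<And>x i. x \<in> topspace (nsphere n) \<Longrightarrow> i \<ge> m \<Longrightarrow> f x i = 0"
    by (subst (asm) nsphere_eq_top_of_set, force)+
  define g where "g = (\<lambda>x. normalise n (f x))"
  have g: "continuous_map (nsphere n) (nsphere n) g"
    unfolding continuous_map_nsphere_iff g_def
    using nz ft m by (auto intro!: continuous_on_normalise[OF fc] normalise_in_nsphere)
  have "odd (Brouwer_degree2 n g)"
    by (rule Borsuk_odd_mapping_degree[OF n g]) (simp add: g_def odd normalise_uminus)
  moreover have "(\<lambda>i. if i = n then 1 else 0) \<notin> g ` topspace (nsphere n)"
  proof
    assume "(\<lambda>i. if i = n then 1 else 0) \<in> g ` topspace (nsphere n)"
    then obtain x where x: "x \<in> topspace (nsphere n)" "g x = (\<lambda>i. if i = n then 1 else 0)"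
      by force
    then have "g x n = 1"
      by simp
    moreover have "g x n = 0"
      using ft[OF x(1) m] by (simp add: g_def normalise_def)
    ultimately show False
      by simp
  qed
  moreover have "(\<lambda>i. if i = n then 1 else 0) \<in> topspace (nsphere n)"
    by (simp add: topspace_nsphere_iff if_distrib[of "\<lambda>x. x\<^sup>2"] cong: if_cong)
  ultimately have "odd (Brouwer_degree2 n g)" "g ` topspace (nsphere n) \<noteq> topspace (nsphere n)"
    by blast+
  then show False
    using Brouwer_degree2_nonsurjective[OF g] by simp
qed

section \<open>Krasnoselskii genus\<close>

definition odd_nonvanishing_map :: "(real ^ 'n::finite) set \<Rightarrow> nat \<Rightarrow> bool" where
  "odd_nonvanishing_map S m \<longleftrightarrow> m > 0 \<and>
     (\<exists>f. continuous_map (top_of_set S) (Euclidean_space m) f \<and>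
          (\<forall>x\<in>S. f x \<noteq> (\<lambda>i. 0)) \<and>
          (\<forall>x\<in>S. f (- x) = (\<lambda>i. - f x i)))"

lemma genus_eq_Least: "genus S = (LEAST m. odd_nonvanishing_map S m)"
  by (simp add: genus_def odd_nonvanishing_map_def)

lemma odd_nonvanishing_coordinates:
  fixes W :: "'n::finite set"
  assumes "W \<noteq> {}" and nz: "\<And>x. x \<in> S \<Longrightarrow> \<exists>v\<in>W. x $ v \<noteq> 0"
  shows "odd_nonvanishing_map S (card W)"
proof -
  obtain b where b: "bij_betw b {..<card W} W"
    using ex_bij_betw_nat_finite[of W] by (auto simp: atLeast0LessThan)
  define f where "f = (\<lambda>x i. if i < card W then x $ b i else (0::real))"
  have "continuous_map (top_of_set S) (Euclidean_space (card W)) f"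
    unfolding f_def continuous_map_componentwise_Euclidean_space
    by (auto intro!: continuous_intros)
  moreover have "f x \<noteq> (\<lambda>i. 0)" if x: "x \<in> S" for x
  proof -
    obtain v where v: "v \<in> W" "x $ v \<noteq> 0"
      using nz[OF x] by blast
    then have "v \<in> b ` {..<card W}"
      using b by (simp add: bij_betw_def)
    then obtain i where "i < card W" "b i = v"
      by blast
    then have "f x i \<noteq> 0"
      using v by (simp add: f_def)
    then show ?thesis
      by auto
  qed
  moreover have "f (- x) = (\<lambda>i. - f x i)" for x
    by (auto simp: f_def)
  ultimately show ?thesis
    using \<open>W \<noteq> {}\<close> unfolding odd_nonvanishing_map_def by (auto simp: card_gt_0_iff)
qed

lemma vanishing_point_if_genus_large:
  fixes W :: "'n::finite set"
  assumes "S \<noteq> {}" and "card W < genus S"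
  obtains x where "x \<in> S" "\<And>v. v \<in> W \<Longrightarrow> x $ v = 0"
proof -
  have "\<exists>x\<in>S. \<forall>v\<in>W. x $ v = 0"
  proof (rule ccontr)
    assume "\<not> ?thesis"
    then have nz: "\<exists>v\<in>W. x $ v \<noteq> 0" if "x \<in> S" for x
      using that by blast
    then have "odd_nonvanishing_map S (card W)"
      using \<open>S \<noteq> {}\<close> by (intro odd_nonvanishing_coordinates) auto
    then have "genus S \<le> card W"
      unfolding genus_eq_Least by (rule Least_le)
    then show False
      using assms(2) by simp
  qed
  then show thesis
    using that by blast
qed

text \<open>
  An odd map \<open>S \<rightarrow> \<real>\<^sup>m\<close> without zeros would, composed with \<open>\<iota>\<close>, contradict the Borsuk--Ulam
  theorem for \<open>m \<le> n\<close>.  All coordinates together show that some such \<open>m\<close> exists, so that the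
  genus is not the default value of \<open>LEAST\<close>.
\<close>

lemma genus_odd_sphere_image:
  fixes \<iota> :: "(nat \<Rightarrow> real) \<Rightarrow> real ^ 'n::finite"
  assumes n: "n < CARD('n)"
    and cont: "continuous_on (topspace (nsphere n)) \<iota>"
    and odd: "\<And>t. t \<in> topspace (nsphere n) \<Longrightarrow> \<iota> (\<lambda>i. - t i) = - \<iota> t"
    and nz: "\<And>t. t \<in> topspace (nsphere n) \<Longrightarrow> \<iota> t \<noteq> 0"
  shows "Suc n \<le> genus (\<iota> ` topspace (nsphere n))"
proof (rule ccontr)
  define S where "S = \<iota> ` topspace (nsphere n)"
  assume "\<not> Suc n \<le> genus (\<iota> ` topspace (nsphere n))"
  then have le: "genus S \<le> n"
    by (simp add: S_def)
  have "odd_nonvanishing_map S (card (UNIV :: 'n set))"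
    using nz by (intro odd_nonvanishing_coordinates) (auto simp: S_def vec_eq_iff)
  then have "odd_nonvanishing_map S (genus S)"
    unfolding genus_eq_Least by (rule LeastI)
  then obtain f where f: "continuous_map (top_of_set S) (Euclidean_space (genus S)) f"
    "\<And>x. x \<in> S \<Longrightarrow> f x \<noteq> (\<lambda>i. 0)" "\<And>x. x \<in> S \<Longrightarrow> f (- x) = (\<lambda>i. - f x i)"
    unfolding odd_nonvanishing_map_def by blast
  have "continuous_map (top_of_set (topspace (nsphere n))) (top_of_set S) \<iota>"
    using cont by (auto simp: S_def)
  then have "continuous_map (nsphere n) (top_of_set S) \<iota>"
    by (subst nsphere_eq_top_of_set)
  then have "continuous_map (nsphere n) (Euclidean_space (genus S)) (f \<circ> \<iota>)"
    using f(1) by (rule continuous_map_compose)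
  moreover have "(f \<circ> \<iota>) (\<lambda>i. - t i) = (\<lambda>i. - (f \<circ> \<iota>) t i)" if "t \<in> topspace (nsphere n)" for t
    using that f(3)[of "\<iota> t"] by (simp add: odd S_def)
  moreover have "n < DIM(real ^ 'n)"
    using n by simp
  ultimately obtain t where "t \<in> topspace (nsphere n)" "(f \<circ> \<iota>) t = (\<lambda>i. 0)"
    using Borsuk_Ulam_nsphere[OF _ le, where 'a = "real ^ 'n"] by metis
  then show False
    using f(2)[of "\<iota> t"] by (simp add: S_def)
qed

section \<open>Inequalities for real powers\<close>

text \<open>
  The odd extension of the power function; its derivative is \<open>p * \<bar>t\<bar> powr (p - 1)\<close>.
\<close>

definition signed_powr :: "real \<Rightarrow> real \<Rightarrow> real" where
  "signed_powr p t = sgn t * \<bar>t\<bar> powr p"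

lemma powr_tangent_young:
  fixes p t \<tau> :: real
  assumes p: "p > 1" and t: "t > 0" and \<tau>: "\<tau> \<ge> 0"
  shows "p * \<tau> * t powr (p - 1) \<le> \<tau> powr p + (p - 1) * t powr p"
proof -
  define q where "q = p / (p - 1)"
  have "\<tau> * t powr (p - 1) \<le> \<tau> powr p / p + (t powr (p - 1)) powr q / q"
    using assms by (intro Youngs_inequality) (auto simp: q_def field_simps)
  also have "(t powr (p - 1)) powr q = t powr p"
    using p by (simp add: powr_powr q_def)
  finally have "p * (\<tau> * t powr (p - 1)) \<le> p * (\<tau> powr p / p + t powr p / q)"
    using p by (intro mult_left_mono) auto
  also have "\<dots> = \<tau> powr p + (p - 1) * t powr p"
    using p by (simp add: q_def field_simps)
  finally show ?thesis
    by (simp add: mult.assoc)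
qed

lemma powr_le_chord:
  fixes p t a b :: real
  assumes p: "p \<ge> 1" and t: "0 \<le> b" "b < t" "t < a"
  shows "t powr p \<le> b powr p + (a powr p - b powr p) * ((t - b) / (a - b))"
proof (cases "b = 0")
  case True
  have "(t / a) powr p \<le> (t / a) powr 1"
    using assms by (intro powr_mono') auto
  then show ?thesis
    using assms True by (simp add: powr_divide field_simps)
next
  case False
  define s where "s = (t - b) / (a - b)"
  have s: "0 \<le> s" "s \<le> 1"
    using t by (auto simp: s_def)
  have "s * (a - b) = t - b"
    using t by (simp add: s_def)
  then have ts: "t = (1 - s) * b + s * a"
    by (simp add: algebra_simps)
  have "t powr p \<le> (1 - s) * b powr p + s * a powr p"
    using convex_onD[OF powr_convex[OF p], of s b a] s t False by (simp add: ts)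
  then show ?thesis
    unfolding s_def[symmetric] by (simp add: algebra_simps)
qed

text \<open>
  With \<open>\<tau> = c (a - b)\<close>, integrate Young's inequality \<open>p \<tau> t\<^sup>p\<^sup>-\<^sup>1 \<le> \<tau>\<^sup>p + (p - 1) t\<^sup>p\<close> over \<open>[b, a]\<close>, bound
  \<open>t\<^sup>p\<close> by its chord, and divide by \<open>a - b\<close>.
\<close>

lemma powr_diff_young_nonneg:
  fixes p c a b :: real
  assumes p: "p \<ge> 1" and c: "c \<ge> 0" and ab: "0 \<le> b" "b \<le> a"
  shows "c * (a powr p - b powr p) \<le> c powr p * (a - b) powr p + (p - 1) * (a powr p + b powr p) / 2"
proof (cases "p = 1 \<or> a = b")
  case True
  then show ?thesis
    using ab c p by auto
next
  case False
  then have p1: "p > 1" and ab': "b < a"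
    using p ab by auto
  define \<tau> where "\<tau> = c * (a - b)"
  define A where "A = a powr p"
  define B where "B = b powr p"
  obtain d where d: "d = a - b" "d \<noteq> 0"
    using ab' by simp
  define K where "K = (A - B) / (2 * d)"
  have K: "2 * K * (a - b) = A - B"
    using d(2) by (simp add: K_def flip: d(1))
  (* Up to a constant, the difference of the two sides of Young's inequality, integrated from
     b to t with the chord in place of t^p; K is half the slope of the chord. *)
  define \<Phi> where "\<Phi> = (\<lambda>t. \<tau> powr p * (t - b)
     + (p - 1) * (B * (t - b) + K * (t - b)\<^sup>2) - \<tau> * t powr p)"
  have "\<Phi> b \<le> \<Phi> a"
  proof (rule DERIV_nonneg_imp_increasing_open[where f = \<Phi>])
    show "b \<le> a" by fact
    show "continuous_on {b..a} \<Phi>"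
      unfolding \<Phi>_def using p1 ab ab' by (intro continuous_intros continuous_on_powr') auto
    fix t assume t: "b < t" "t < a"
    define L where "L = B + 2 * K * (t - b)"
    have "t > 0"
      using t ab by simp
    then have "(\<Phi> has_real_derivative \<tau> powr p + (p - 1) * L - \<tau> * (p * t powr (p - 1))) (at t)"
      unfolding \<Phi>_def L_def by (auto intro!: derivative_eq_intros)
    moreover have "t powr p \<le> B + (A - B) * ((t - b) / (a - b))"
      unfolding A_def B_def by (rule powr_le_chord) (use p ab t in auto)
    then have "t powr p \<le> L"
      using ab' by (simp add: L_def flip: K)
    then have "(p - 1) * t powr p \<le> (p - 1) * L"
      using p by (intro mult_left_mono) auto
    moreover have "p * \<tau> * t powr (p - 1) \<le> \<tau> powr p + (p - 1) * t powr p"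
      using t ab c by (intro powr_tangent_young p1) (auto simp: \<tau>_def)
    ultimately show "\<exists>y. DERIV \<Phi> t :> y \<and> y \<ge> 0"
      by (intro exI[of _ "\<tau> powr p + (p - 1) * L - \<tau> * (p * t powr (p - 1))"]) (simp add: mult_ac)
  qed
  then have "\<tau> * (A - B) \<le> \<tau> powr p * (a - b) + (p - 1) * (B * (a - b) + K * (a - b)\<^sup>2)"
    by (simp add: \<Phi>_def A_def B_def right_diff_distrib)
  also have "K * (a - b)\<^sup>2 = (A - B) / 2 * (a - b)"
    by (simp add: power2_eq_square flip: K)
  also have "\<tau> powr p * (a - b) + (p - 1) * (B * (a - b) + (A - B) / 2 * (a - b))
      = (a - b) * (\<tau> powr p + (p - 1) * (A + B) / 2)"
    by (simp add: field_simps)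
  finally have "(a - b) * (c * (A - B)) \<le> (a - b) * (\<tau> powr p + (p - 1) * (A + B) / 2)"
    by (simp add: \<tau>_def mult.assoc mult.left_commute)
  then have "c * (A - B) \<le> \<tau> powr p + (p - 1) * (A + B) / 2"
    using ab' by simp
  then show ?thesis
    using c ab' by (simp add: \<tau>_def powr_mult A_def B_def)
qed

lemma powr_superadditive:
  fixes p a b :: real
  assumes "p \<ge> 1" "a \<ge> 0" "b \<ge> 0"
  shows "a powr p + b powr p \<le> (a + b) powr p"
proof (cases "a + b = 0")
  case False
  then have pos: "a + b > 0"
    using assms by simp
  have "(a / (a + b)) powr p \<le> (a / (a + b)) powr 1" "(b / (a + b)) powr p \<le> (b / (a + b)) powr 1"
    using assms pos by (intro powr_mono'; simp)+
  then have "(a / (a + b)) powr p + (b / (a + b)) powr p \<le> a / (a + b) + b / (a + b)"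
    using assms pos by simp
  also have "\<dots> = 1"
    using pos by (simp flip: add_divide_distrib)
  finally show ?thesis
    using pos assms by (simp add: powr_divide field_simps)
qed (use assms in \<open>simp add: add_nonneg_eq_0_iff\<close>)

text \<open>
  The free parameter \<open>c\<close> takes the place of Hoelder's inequality: this form is additive, so it can
  be summed over the edges at once and \<open>c\<close> chosen afterwards.
\<close>

lemma signed_powr_diff_young:
  fixes p c a b :: real
  assumes p: "p \<ge> 1" and c: "c \<ge> 0"
  shows "c * \<bar>signed_powr p a - signed_powr p b\<bar>
    \<le> c powr p * \<bar>a - b\<bar> powr p + (p - 1) * (\<bar>a\<bar> powr p + \<bar>b\<bar> powr p) / 2"
proof -
  have nonneg: "c * \<bar>signed_powr p a - signed_powr p b\<bar>
      \<le> c powr p * \<bar>a - b\<bar> powr p + (p - 1) * (\<bar>a\<bar> powr p + \<bar>b\<bar> powr p) / 2"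
    if "0 \<le> b" "b \<le> a" for a b
  proof -
    have "signed_powr p a = a powr p" "signed_powr p b = b powr p"
      using that by (auto simp: signed_powr_def sgn_if)
    moreover have "b powr p \<le> a powr p"
      using that p by (intro powr_mono2) auto
    ultimately show ?thesis
      using powr_diff_young_nonneg[OF p c that] that by simp
  qed
  have opposite: "c * \<bar>signed_powr p a - signed_powr p b\<bar>
      \<le> c powr p * \<bar>a - b\<bar> powr p + (p - 1) * (\<bar>a\<bar> powr p + \<bar>b\<bar> powr p) / 2"
    if "b \<le> 0" "0 \<le> a" for a b
  proof -
    have "signed_powr p a = a powr p" "signed_powr p b = - ((- b) powr p)"
      using that by (auto simp: signed_powr_def sgn_if)
    then have "c * \<bar>signed_powr p a - signed_powr p b\<bar> = c * (a powr p) + c * ((- b) powr p)"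
      by (simp add: algebra_simps)
    also have "\<dots> \<le> c powr p * (a powr p + (- b) powr p) + (p - 1) * (a powr p + (- b) powr p) / 2"
      using powr_diff_young_nonneg[OF p c, of 0 a] powr_diff_young_nonneg[OF p c, of 0 "- b"] that
      by (simp add: algebra_simps add_divide_distrib diff_divide_distrib)
    also have "c powr p * (a powr p + (- b) powr p) \<le> c powr p * (a + (- b)) powr p"
      using that p by (intro mult_left_mono powr_superadditive) auto
    finally show ?thesis
      using that by simp
  qed
  have minus: "signed_powr p (- t) = - signed_powr p t" for t
    by (simp add: signed_powr_def)
  have swap: "\<bar>signed_powr p b - signed_powr p a\<bar> = \<bar>signed_powr p a - signed_powr p b\<bar>"
    "\<bar>b - a\<bar> = \<bar>a - b\<bar>" "\<bar>b\<bar> powr p + \<bar>a\<bar> powr p = \<bar>a\<bar> powr p + \<bar>b\<bar> powr p"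
    "\<bar>- signed_powr p a + signed_powr p b\<bar> = \<bar>signed_powr p a - signed_powr p b\<bar>"
    "\<bar>- signed_powr p b + signed_powr p a\<bar> = \<bar>signed_powr p a - signed_powr p b\<bar>"
    "\<bar>- a + b\<bar> = \<bar>a - b\<bar>" "\<bar>- b + a\<bar> = \<bar>a - b\<bar>"
    by auto
  consider "0 \<le> b" "b \<le> a" | "0 \<le> a" "a \<le> b" | "b \<le> 0" "0 \<le> a" | "a \<le> 0" "0 \<le> b"
    | "a \<le> b" "b \<le> 0" | "b \<le> a" "a \<le> 0"
    by linarith
  then show ?thesis
  proof cases
    case 2
    then show ?thesis
      using nonneg[of a b] by (simp add: swap add.commute)
  next
    case 4
    then show ?thesis
      using opposite[of a b] by (simp add: swap add.commute)
  next
    case 5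
    then show ?thesis
      using nonneg[of "- b" "- a"] by (simp add: minus swap)
  next
    case 6
    then show ?thesis
      using nonneg[of "- a" "- b"] by (simp add: minus swap add.commute)
  qed (use nonneg[of b a] opposite[of b a] in auto)
qed

lemma powr_abs_diff_le:
  fixes p a b :: real
  assumes p: "p \<ge> 1"
  shows "\<bar>a - b\<bar> powr p \<le> 2 powr (p - 1) * (\<bar>a\<bar> powr p + \<bar>b\<bar> powr p)"
proof -
  have "((x + y) / 2) powr p \<le> (x powr p + y powr p) / 2" if "0 \<le> x" "x \<le> y" for x y
  proof (cases "x = y")
    case False
    have half: "((x + y) / 2 - x) / (y - x) = 1 / 2"
      using that False by (simp add: field_simps)
    have "((x + y) / 2) powr p \<le> x powr p + (y powr p - x powr p) * (((x + y) / 2 - x) / (y - x))"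
      using that False by (intro powr_le_chord p) auto
    then show ?thesis
      unfolding half by (simp add: field_simps)
  qed simp
  from this[of "\<bar>a\<bar>" "\<bar>b\<bar>"] this[of "\<bar>b\<bar>" "\<bar>a\<bar>"]
  have "((\<bar>a\<bar> + \<bar>b\<bar>) / 2) powr p \<le> (\<bar>a\<bar> powr p + \<bar>b\<bar> powr p) / 2"
    by (cases "\<bar>a\<bar> \<le> \<bar>b\<bar>") (simp_all add: add.commute)
  then have "(\<bar>a\<bar> + \<bar>b\<bar>) powr p \<le> 2 powr (p - 1) * (\<bar>a\<bar> powr p + \<bar>b\<bar> powr p)"
    by (simp add: powr_divide powr_diff field_simps)
  moreover have "\<bar>a - b\<bar> powr p \<le> (\<bar>a\<bar> + \<bar>b\<bar>) powr p"
    using p by (intro powr_mono2) auto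
  ultimately show ?thesis
    by linarith
qed

section \<open>Subtrees of a spanning forest\<close>

text \<open>
  Connectedness of the induced subgraph on \<open>A\<close>, in terms of cuts: this is what minimality of a set of
  small expansion gives.
\<close>

definition inner_connected :: "'a set set \<Rightarrow> 'a set \<Rightarrow> bool" where
  "inner_connected E A \<longleftrightarrow>
     (\<forall>B. B \<noteq> {} \<and> B \<subset> A \<longrightarrow> (\<exists>u\<in>B. \<exists>v\<in>A - B. {u, v} \<in> E))"

text \<open>
  A rooted forest is a parent map on the set \<open>N\<close> of non-roots under which a depth function decreases.
  A vertex of \<open>A\<close> whose parent is not in \<open>A\<close> has all of \<open>A\<close> among its descendants, since no tree
  edge inside \<open>A\<close> leaves the set of its descendants.  There is thus only one such vertex, the
  shallowest one.
\<close>

lemma top_vertex_exists: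
  assumes forest: "\<And>v. v \<in> N \<Longrightarrow> d (par v) < (d v :: nat)"
    and "A \<noteq> {}" and conn: "inner_connected {{v, par v} | v. v \<in> N} A"
  obtains t where "t \<in> A" "\<And>v. v \<in> A \<Longrightarrow> v \<noteq> t \<Longrightarrow> v \<in> N \<and> par v \<in> A" "\<And>v. v \<in> A \<Longrightarrow> d t \<le> d v"
proof -
  define desc where "desc = (\<lambda>t. {v. (v, t) \<in> {(v, par v) | v. v \<in> N}\<^sup>*})"
  have desc_step: "par v \<in> desc t" if "v \<in> desc t" "v \<noteq> t" for v t
    using that unfolding desc_def by (auto elim: converse_rtranclE)
  have desc_up: "v \<in> desc t" if "par v \<in> desc t" "v \<in> N" for v t
    using that unfolding desc_def by (auto intro: converse_rtrancl_into_rtrancl)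
  have desc_depth: "v = t \<or> d t < d v" if "v \<in> desc t" for v t
  proof -
    have "(v, t) \<in> {(v, par v) | v. v \<in> N}\<^sup>*"
      using that by (simp add: desc_def)
    then show ?thesis
    proof (induction rule: converse_rtrancl_induct)
      case (step y z)
      then show ?case
        using forest[of y] by auto
    qed simp
  qed
  have below: "A \<subseteq> desc t" if t: "t \<in> A" "\<not> (t \<in> N \<and> par t \<in> A)" for t
  proof (rule ccontr)
    assume "\<not> A \<subseteq> desc t"
    moreover have "t \<in> A \<inter> desc t"
      using t by (simp add: desc_def)
    ultimately have "A \<inter> desc t \<noteq> {}" "A \<inter> desc t \<subset> A"
      by auto
    then obtain u v where uv: "u \<in> A \<inter> desc t" "v \<in> A - A \<inter> desc t"
        "{u, v} \<in> {{v, par v} | v. v \<in> N}"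
      using conn unfolding inner_connected_def by meson
    then consider "v = par u" "u \<in> N" | "u = par v" "v \<in> N"
      by (auto simp: doubleton_eq_iff)
    then show False
    proof cases
      case 1
      then have "u \<noteq> t"
        using t uv by auto
      then show False
        using desc_step[of u t] 1 uv by auto
    next
      case 2
      then show False
        using desc_up[of v t] uv by auto
    qed
  qed
  obtain s where "s \<in> A"
    using \<open>A \<noteq> {}\<close> by blast
  then obtain t where t: "t \<in> A" "\<And>v. v \<in> A \<Longrightarrow> d t \<le> d v"
    using ex_has_least_nat[of "\<lambda>v. v \<in> A" s d] by blast
  have "v \<in> N \<and> par v \<in> A" if v: "v \<in> A" "v \<noteq> t" for v
  proof (rule ccontr)
    assume "\<not> (v \<in> N \<and> par v \<in> A)"
    then have "t \<in> desc v"
      using below[OF v(1)] t(1) by auto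
    then have "d v < d t"
      using desc_depth[of t v] v(2) by auto
    then show False
      using t(2)[OF v(1)] by simp
  qed
  with t show thesis
    using that by blast
qed

text \<open>
  Greedily pick the member \<open>A\<close> whose top vertex is deepest.  Climbing from a common vertex of \<open>A\<close> and
  another member \<open>B\<close> reaches the top of \<open>A\<close> before it can leave \<open>B\<close>.  So the top of \<open>A\<close> meets every
  member that is not disjoint from \<open>A\<close>, and the others are handled by induction.
\<close>

lemma subtree_packing_covering:
  assumes forest: "\<And>v. v \<in> N \<Longrightarrow> d (par v) < (d v :: nat)"
    and "finite F"
    and "\<And>A. A \<in> F \<Longrightarrow> A \<noteq> {}"
    and "\<And>A. A \<in> F \<Longrightarrow> inner_connected {{v, par v} | v. v \<in> N} A"
  shows "\<exists>P W. P \<subseteq> F \<and> disjoint P \<and> card W \<le> card P \<and> (\<forall>A\<in>F. A \<inter> W \<noteq> {})"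
  using assms(2-)
proof (induction F rule: finite_psubset_induct)
  case (psubset F)
  show ?case
  proof (cases "F = {}")
    case True
    then show ?thesis
      by (intro exI[of _ "{}"]) auto
  next
    case False
    define is_top where "is_top = (\<lambda>A t. t \<in> A \<and>
      (\<forall>v\<in>A. v \<noteq> t \<longrightarrow> v \<in> N \<and> par v \<in> A) \<and> (\<forall>v\<in>A. d t \<le> d v))"
    have "\<exists>t. is_top A t" if A: "A \<in> F" for A
    proof (rule top_vertex_exists[where N = N and d = d and par = par])
      show "d (par v) < d v" if "v \<in> N" for v
        using that by (rule forest)
      show "A \<noteq> {}" "inner_connected {{v, par v} | v. v \<in> N} A"
        using A by (rule psubset.prems)+
      fix t assume "t \<in> A" "\<And>v. v \<in> A \<Longrightarrow> v \<noteq> t \<Longrightarrow> v \<in> N \<and> par v \<in> A" "\<And>v. v \<in> A \<Longrightarrow> d t \<le> d v"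
      then show "\<exists>t. is_top A t"
        by (intro exI[of _ t]) (simp add: is_top_def)
    qed
    then obtain top where top: "\<And>A. A \<in> F \<Longrightarrow> is_top A (top A)"
      by metis
    have "Max ((\<lambda>B. d (top B)) ` F) \<in> (\<lambda>B. d (top B)) ` F"
      using False \<open>finite F\<close> by (intro Max_in) auto
    then obtain A where A: "A \<in> F" "Max ((\<lambda>B. d (top B)) ` F) = d (top A)"
      by blast
    have deepest: "d (top B) \<le> d (top A)" if "B \<in> F" for B
      unfolding A(2)[symmetric] using that \<open>finite F\<close> by (intro Max_ge) auto
    define F' where "F' = {B \<in> F. top A \<notin> B}"
    have "top A \<in> A"
      using top[OF A(1)] by (simp add: is_top_def)
    then have "F' \<subset> F"
      using A(1) by (auto simp: F'_def)
    then have "\<exists>P W. P \<subseteq> F' \<and> disjoint P \<and> card W \<le> card P \<and> (\<forall>B\<in>F'. B \<inter> W \<noteq> {})"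
      by (rule psubset.IH) (rule psubset.prems, simp add: F'_def)+
    then obtain P W where PW: "P \<subseteq> F'" "disjoint P" "card W \<le> card P" "\<forall>B\<in>F'. B \<inter> W \<noteq> {}"
      by (elim exE conjE)
    have meets: "A \<inter> B = {}" if B: "B \<in> F'" for B
    proof (rule ccontr)
      assume "A \<inter> B \<noteq> {}"
      then obtain u where "u \<in> A \<inter> B"
        by blast
      (* The climb is replaced by a common vertex of least depth. *)
      then obtain v where v: "v \<in> A \<inter> B" "\<And>u. u \<in> A \<inter> B \<Longrightarrow> d v \<le> d u"
        using ex_has_least_nat[of "\<lambda>v. v \<in> A \<inter> B" u d] by blast
      have BF: "B \<in> F" "top A \<notin> B"
        using B by (auto simp: F'_def)
      then have "v \<noteq> top A"
        using v(1) by auto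
      then have par: "v \<in> N" "par v \<in> A"
        using top[OF A(1)] v(1) by (auto simp: is_top_def)
      then have lt: "d (par v) < d v"
        by (intro forest)
      have "v \<noteq> top B"
      proof
        assume "v = top B"
        then have "d v \<le> d (top A)"
          using deepest[OF BF(1)] by simp
        also have "d (top A) \<le> d (par v)"
          using top[OF A(1)] par(2) by (auto simp: is_top_def)
        finally show False
          using lt by simp
      qed
      then have "par v \<in> B"
        using top[OF BF(1)] v(1) by (auto simp: is_top_def)
      then show False
        using v(2)[of "par v"] par(2) lt by auto
    qed
    have "A \<notin> P"
      using PW(1) \<open>top A \<in> A\<close> by (auto simp: F'_def)
    have "finite P"
      using finite_subset[OF PW(1)] \<open>F' \<subset> F\<close> \<open>finite F\<close> by (simp add: F'_def)
    have "disjnt A B \<and> disjnt B A" if "B \<in> P" for B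
      using meets[of B] PW(1) that by (auto simp: disjnt_def)
    then have "disjoint (insert A P)"
      using PW(2) by (simp add: pairwise_insert)
    moreover have "card (insert (top A) W) \<le> card (insert A P)"
      using PW(3) \<open>A \<notin> P\<close> \<open>finite P\<close> card_insert_le_m1[of "card P + 1" W "top A"]
      by (simp add: card_insert_if)
    moreover have "\<forall>B\<in>F. B \<inter> insert (top A) W \<noteq> {}"
      using PW(4) by (auto simp: F'_def)
    moreover have "insert A P \<subseteq> F"
      using A(1) PW(1) \<open>F' \<subset> F\<close> by blast
    ultimately show ?thesis
      by blast
  qed
qed

text \<open>
  Breadth-first search: \<open>d\<close> is the distance to a chosen root of the component, and every non-root has
  a neighbour that is closer to the root.
\<close>

lemma spanning_forest_exists:
  fixes E :: "'n::finite set set"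
  obtains N and par :: "'n \<Rightarrow> 'n" and d :: "'n \<Rightarrow> nat" where
    "\<And>v. v \<in> N \<Longrightarrow> d (par v) < d v" "\<And>v. v \<in> N \<Longrightarrow> {v, par v} \<in> E"
    "card N + num_components E = CARD('n)"
proof -
  define R where "R = {(u, v). {u, v} \<in> E}"
  have symR: "sym R"
    by (auto simp: R_def sym_def insert_commute)
  have equiv: "equiv UNIV (R\<^sup>*)"
    using symR by (simp add: equiv_def refl_rtrancl sym_rtrancl trans_rtrancl)
  define root where "root = (\<lambda>v. SOME r. r \<in> R\<^sup>* `` {v})"
  have root: "(root v, v) \<in> R\<^sup>*" for v
  proof -
    have "root v \<in> R\<^sup>* `` {v}"
      unfolding root_def by (rule someI[of _ v]) auto
    then show ?thesis
      using sym_rtrancl[OF symR] by (auto simp: sym_def)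
  qed
  have root_eq: "root u = root v" if "(u, v) \<in> R\<^sup>*" for u v
    unfolding root_def by (simp only: equiv_class_eq[OF equiv that])
  define d where "d = (\<lambda>v. LEAST i. (root v, v) \<in> R ^^ i)"
  have d: "(root v, v) \<in> R ^^ d v" for v
  proof -
    from rtrancl_imp_relpow[OF root[of v]] obtain i where "(root v, v) \<in> R ^^ i"
      by (rule exE)
    then show ?thesis
      unfolding d_def by (rule LeastI)
  qed
  have d_le: "d v \<le> i" if "(root v, v) \<in> R ^^ i" for v i
    unfolding d_def using that by (rule Least_le)
  define N where "N = {v. v \<noteq> root v}"
  have "\<exists>u. (u, v) \<in> R \<and> d u < d v" if "v \<in> N" for v
  proof -
    have "d v \<noteq> 0"
    proof
      assume "d v = 0"
      from d[of v, unfolded this] show False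
        using that by (simp add: N_def)
    qed
    then obtain i where i: "d v = Suc i"
      by (rule not0_implies_Suc[THEN exE])
    from d[of v, unfolded i] obtain u where u: "(root v, u) \<in> R ^^ i" "(u, v) \<in> R"
      by (rule relpow_Suc_E)
    then have "root u = root v"
      by (intro root_eq r_into_rtrancl)
    then have "d u \<le> i"
      using u(1) by (intro d_le) simp
    then show ?thesis
      using u(2) i by (intro exI[of _ u]) simp
  qed
  then obtain par where par: "\<And>v. v \<in> N \<Longrightarrow> (par v, v) \<in> R \<and> d (par v) < d v"
    by metis
  have "bij_betw (\<lambda>r. R\<^sup>* `` {r}) (- N) (UNIV // R\<^sup>*)"
    unfolding bij_betw_def
  proof
    show "inj_on (\<lambda>r. R\<^sup>* `` {r}) (- N)"
    proof (rule inj_onI)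
      fix r s assume rs: "r \<in> - N" "s \<in> - N" "R\<^sup>* `` {r} = R\<^sup>* `` {s}"
      have "root r = root s"
        unfolding root_def rs(3) ..
      have "r = root r" "s = root s"
        using rs(1,2) unfolding N_def Compl_iff mem_Collect_eq not_not .
      then show "r = s"
        using \<open>root r = root s\<close> by metis
    qed
    show "(\<lambda>r. R\<^sup>* `` {r}) ` (- N) = UNIV // R\<^sup>*"
    proof
      show "UNIV // R\<^sup>* \<subseteq> (\<lambda>r. R\<^sup>* `` {r}) ` (- N)"
      proof
        fix C assume "C \<in> UNIV // R\<^sup>*"
        then obtain v where v: "C = R\<^sup>* `` {v}"
          by (rule quotientE)
        have "C = R\<^sup>* `` {root v}"
          unfolding v using equiv_class_eq[OF equiv root[of v]] by (rule sym)
        moreover have "root v \<in> - N"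
          using root_eq[OF root[of v]] by (simp add: N_def)
        ultimately show "C \<in> (\<lambda>r. R\<^sup>* `` {r}) ` (- N)"
          by blast
      qed
    qed (auto simp: quotient_def)
  qed
  then have "num_components E = card (- N)"
    unfolding num_components_def R_def[symmetric] by (rule bij_betw_same_card[symmetric])
  then have card_N: "card N + num_components E = CARD('n)"
    using card_mono[of UNIV N] by (simp add: Compl_eq_Diff_UNIV card_Diff_subset)
  show thesis
  proof (rule that)
    show "d (par v) < d v" if "v \<in> N" for v
      using par[OF that] ..
    show "{v, par v} \<in> E" if "v \<in> N" for v
    proof -
      have "{par v, v} \<in> E"
        using par[OF that] by (simp add: R_def)
      then show ?thesis
        by (simp add: insert_commute)
    qed
  qed (rule card_N)
qed

text \<open>
  \<open>U\<close> takes one endpoint of each edge outside a spanning forest, and there are \<open>cycle_rank E\<close> of these.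
  All edges between vertices outside \<open>U\<close> are tree edges.
\<close>

lemma feedback_vertex_cover:
  fixes E :: "'n::finite set set"
  assumes edge: "{} \<notin> E"
  obtains N U and par :: "'n \<Rightarrow> 'n" and d :: "'n \<Rightarrow> nat" where
    "\<And>v. v \<in> N \<Longrightarrow> d (par v) < d v" "int (card U) \<le> cycle_rank E"
    "\<And>A. A \<inter> U = {} \<Longrightarrow> inner_connected E A \<Longrightarrow> inner_connected {{v, par v} | v. v \<in> N} A"
proof -
  obtain N and par :: "'n \<Rightarrow> 'n" and d :: "'n \<Rightarrow> nat" where
    forest: "\<And>v. v \<in> N \<Longrightarrow> d (par v) < d v" and tree: "\<And>v. v \<in> N \<Longrightarrow> {v, par v} \<in> E"
    and card_N: "card N + num_components E = CARD('n)"
    by (rule spanning_forest_exists[of E]) (rule that)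
  define T where "T = (\<lambda>v. {v, par v}) ` N"
  have inj: "inj_on (\<lambda>v. {v, par v}) N"
  proof (rule inj_onI)
    fix u v assume "u \<in> N" "v \<in> N" "{u, par u} = {v, par v}"
    then show "u = v"
      using forest[of u] forest[of v] by (auto simp: doubleton_eq_iff)
  qed
  have "T \<subseteq> E"
    using tree by (auto simp: T_def)
  have rank: "cycle_rank E = int (card (E - T))"
  proof -
    have "card T = card N"
      unfolding T_def by (rule card_image[OF inj])
    moreover have "card (E - T) + card T = card E"
      using \<open>T \<subseteq> E\<close> by (metis card_Diff_subset card_mono finite le_add_diff_inverse2)
    ultimately show ?thesis
      using card_N by (simp add: cycle_rank_def)
  qed
  define rep where "rep = (\<lambda>e. SOME v. v \<in> (e :: 'n set))"
  have rep: "rep e \<in> e" if "e \<in> E" for e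
    unfolding rep_def some_in_eq using edge that by metis
  have "int (card (rep ` (E - T))) \<le> cycle_rank E"
    unfolding rank by (simp add: card_image_le)
  moreover have "inner_connected {{v, par v} | v. v \<in> N} A"
    if A: "A \<inter> rep ` (E - T) = {}" "inner_connected E A" for A
    unfolding inner_connected_def
  proof (intro allI impI)
    fix B assume B: "B \<noteq> {} \<and> B \<subset> A"
    then obtain u v where uv: "u \<in> B" "v \<in> A - B" "{u, v} \<in> E"
      using A(2) unfolding inner_connected_def by meson
    have "{u, v} \<in> T"
    proof (rule ccontr)
      assume "{u, v} \<notin> T"
      then have "rep {u, v} \<in> rep ` (E - T)"
        using uv(3) by (intro imageI DiffI)
      moreover have "rep {u, v} \<in> A"
        using rep[OF uv(3)] uv(1,2) B by auto
      ultimately show False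
        using A(1) by (simp add: disjoint_iff)
    qed
    then have "{u, v} \<in> {{v, par v} | v. v \<in> N}"
      by (auto simp: T_def)
    then show "\<exists>u\<in>B. \<exists>v\<in>A - B. {u, v} \<in> {{v, par v} | v. v \<in> N}"
      using uv(1,2) by blast
  qed
  ultimately show thesis
    by (intro that[of N d par "rep ` (E - T)"] forest)
qed

section \<open>Coarea inequality and Rayleigh quotients\<close>

lemma edge_boundary_iff:
  "{u, v} \<in> edge_boundary E A \<longleftrightarrow> {u, v} \<in> E \<and> (u \<in> A \<longleftrightarrow> v \<notin> A)"
proof
  assume *: "{u, v} \<in> E \<and> (u \<in> A \<longleftrightarrow> v \<notin> A)"
  show "{u, v} \<in> edge_boundary E A"
  proof (cases "u \<in> A")
    case False
    with * have "{v, u} \<in> E \<and> v \<in> A \<and> u \<notin> A"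
      by (simp add: insert_commute)
    then have "{v, u} \<in> edge_boundary E A"
      unfolding edge_boundary_def by blast
    then show ?thesis
      by (simp add: insert_commute)
  qed (use * in \<open>auto simp: edge_boundary_def\<close>)
qed (auto simp: edge_boundary_def doubleton_eq_iff insert_commute)

lemma edge_boundary_subset: "edge_boundary E A \<subseteq> E"
  by (auto simp: edge_boundary_def)

context weighted_graph
begin

lemma edgeE:
  assumes "e \<in> E"
  obtains u v where "u \<noteq> v" "e = {u, v}" "{u, v} \<in> E" "w e > 0"
proof -
  obtain u v where "u \<noteq> v" "e = {u, v}"
    using edge[OF assms] by blast
  then show thesis
    using that assms edge_weight_pos[OF assms] by simp
qed

lemma energy_term_nonneg: "e \<in> E \<Longrightarrow> 0 \<le> w e * edge_diff x e"
  by (rule edgeE) (auto simp: edge_diff_doubleton intro!: mult_nonneg_nonneg)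

lemma volume_pos: "A \<noteq> {} \<Longrightarrow> (\<Sum>v\<in>A. \<mu> v) > 0"
  by (intro sum_pos vertex_weight_pos) auto

lemma boundary_weight_nonneg: "(\<Sum>e\<in>edge_boundary E A. w e) \<ge> 0"
  using edge_boundary_subset[of E A] edge_weight_pos by (intro sum_nonneg) (auto intro: less_imp_le)

lemma expansion_nonneg: "expansion E \<mu> w A \<ge> 0"
  unfolding expansion_def
  by (intro divide_nonneg_nonneg boundary_weight_nonneg sum_nonneg less_imp_le[OF vertex_weight_pos])

lemma expansion_ge_iff:
  "A \<noteq> {} \<Longrightarrow> h \<le> expansion E \<mu> w A \<longleftrightarrow> h * (\<Sum>v\<in>A. \<mu> v) \<le> (\<Sum>e\<in>edge_boundary E A. w e)"
  using volume_pos[of A] by (simp add: expansion_def pos_le_divide_eq)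

lemma expansion_le_iff:
  "A \<noteq> {} \<Longrightarrow> expansion E \<mu> w A \<le> h \<longleftrightarrow> (\<Sum>e\<in>edge_boundary E A. w e) \<le> h * (\<Sum>v\<in>A. \<mu> v)"
  using volume_pos[of A] by (simp add: expansion_def pos_divide_le_eq)

text \<open>
  The layer-cake decomposition of \<open>x\<close>, by induction on its support: lowering \<open>x\<close> on its support \<open>A\<close> by
  its least positive value \<open>m\<close> lowers the right-hand side by exactly \<open>m\<close> times the weight of the boundary
  of \<open>A\<close>.
\<close>

lemma coarea_nonneg:
  fixes x :: "real ^ 'n"
  assumes "\<And>v. x $ v \<ge> 0"
    and "\<And>A. A \<noteq> {} \<Longrightarrow> (\<And>v. v \<in> A \<Longrightarrow> x $ v > 0) \<Longrightarrow> h \<le> expansion E \<mu> w A"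
  shows "h * (\<Sum>v\<in>UNIV. \<mu> v * x $ v) \<le> (\<Sum>e\<in>E. w e * edge_diff x e)"
  using assms
proof (induction "card {v. x $ v > 0}" arbitrary: x rule: less_induct)
  case less
  define A where "A = {v. x $ v > 0}"
  show ?case
  proof (cases "A = {}")
    case True
    have "x $ v = 0" for v
      using True less.prems(1)[of v] by (auto simp: A_def not_less intro: antisym)
    moreover have "0 \<le> (\<Sum>e\<in>E. w e * edge_diff x e)"
      by (intro sum_nonneg energy_term_nonneg)
    ultimately show ?thesis
      by simp
  next
    case False
    define m where "m = Min (($) x ` A)"
    have "m \<in> ($) x ` A"
      unfolding m_def using False by (intro Min_in) auto
    then obtain a where a: "a \<in> A" "x $ a = m"
      by blast
    have m_le: "m \<le> x $ v" if "v \<in> A" for v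
      unfolding m_def using that by (intro Min_le) auto
    have "m > 0"
      using a by (auto simp: A_def)
    have out: "x $ v = 0" if "v \<notin> A" for v
      using that less.prems(1)[of v] by (auto simp: A_def not_less intro: antisym)
    define y :: "real ^ 'n" where "y = (\<chi> v. if v \<in> A then x $ v - m else 0)"
    have y0: "y $ v \<ge> 0" for v
      using m_le by (simp add: y_def)
    have yA: "v \<in> A" if "y $ v > 0" for v
      using that by (simp add: y_def split: if_splits)
    have "{v. y $ v > 0} \<subset> {v. x $ v > 0}"
      using yA a \<open>m > 0\<close> by (auto simp: A_def y_def)
    then have "card {v. y $ v > 0} < card {v. x $ v > 0}"
      by (intro psubset_card_mono) auto
    then have IH: "h * (\<Sum>v\<in>UNIV. \<mu> v * y $ v) \<le> (\<Sum>e\<in>E. w e * edge_diff y e)"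
    proof (rule less.hyps)
      fix B assume B: "B \<noteq> {}" "\<And>v. v \<in> B \<Longrightarrow> y $ v > 0"
      show "h \<le> expansion E \<mu> w B"
        using B yA by (intro less.prems(2)) (auto simp: A_def)
    qed (rule y0)
    have "(\<Sum>v\<in>UNIV. \<mu> v * x $ v) = (\<Sum>v\<in>UNIV. \<mu> v * y $ v + (if v \<in> A then m * \<mu> v else 0))"
      using out by (intro sum.cong) (auto simp: y_def algebra_simps)
    also have "\<dots> = (\<Sum>v\<in>UNIV. \<mu> v * y $ v) + m * (\<Sum>v\<in>A. \<mu> v)"
      by (simp add: sum.distrib sum.If_cases sum_distrib_left)
    finally have vol: "(\<Sum>v\<in>UNIV. \<mu> v * x $ v) = (\<Sum>v\<in>UNIV. \<mu> v * y $ v) + m * (\<Sum>v\<in>A. \<mu> v)" .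
    have "edge_diff x e = edge_diff y e + (if e \<in> edge_boundary E A then m else 0)" if e: "e \<in> E" for e
    proof -
      obtain u v where uv: "e = {u, v}" "{u, v} \<in> E"
        using e by (rule edgeE)
      then show ?thesis
        using m_le[of u] m_le[of v] out[of u] out[of v] \<open>m > 0\<close>
        by (auto simp: edge_boundary_iff edge_diff_doubleton y_def)
    qed
    then have "(\<Sum>e\<in>E. w e * edge_diff x e)
        = (\<Sum>e\<in>E. w e * edge_diff y e + (if e \<in> edge_boundary E A then m * w e else 0))"
      by (intro sum.cong) (auto simp: algebra_simps)
    also have "\<dots> = (\<Sum>e\<in>E. w e * edge_diff y e) + m * (\<Sum>e\<in>edge_boundary E A. w e)"
      using edge_boundary_subset[of E A]
      by (simp add: sum.distrib sum.If_cases sum_distrib_left Int_absorb1)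
    finally have energy: "(\<Sum>e\<in>E. w e * edge_diff x e)
        = (\<Sum>e\<in>E. w e * edge_diff y e) + m * (\<Sum>e\<in>edge_boundary E A. w e)" .
    have "h \<le> expansion E \<mu> w A"
      using False by (intro less.prems(2)) (auto simp: A_def)
    then have "h * (\<Sum>v\<in>A. \<mu> v) \<le> (\<Sum>e\<in>edge_boundary E A. w e)"
      by (simp only: expansion_ge_iff[OF False])
    then have "m * (h * (\<Sum>v\<in>A. \<mu> v)) \<le> m * (\<Sum>e\<in>edge_boundary E A. w e)"
      using \<open>m > 0\<close> by simp
    then show ?thesis
      unfolding vol energy using IH by (simp add: algebra_simps)
  qed
qed

text \<open>
  Positive and negative part are treated separately; both sides are additive under this splitting,
  even on edges where \<open>x\<close> changes sign.
\<close>

lemma coarea: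
  fixes x :: "real ^ 'n"
  assumes supp: "\<And>A. A \<noteq> {} \<Longrightarrow> (\<And>v. v \<in> A \<Longrightarrow> x $ v \<noteq> 0) \<Longrightarrow> h \<le> expansion E \<mu> w A"
  shows "h * (\<Sum>v\<in>UNIV. \<mu> v * \<bar>x $ v\<bar>) \<le> (\<Sum>e\<in>E. w e * edge_diff x e)"
proof -
  define y :: "real ^ 'n" where "y = (\<chi> v. max (x $ v) 0)"
  define z :: "real ^ 'n" where "z = (\<chi> v. max (- x $ v) 0)"
  have "h * (\<Sum>v\<in>UNIV. \<mu> v * y $ v) \<le> (\<Sum>e\<in>E. w e * edge_diff y e)"
  proof (rule coarea_nonneg)
    show "h \<le> expansion E \<mu> w A" if "A \<noteq> {}" "\<And>v. v \<in> A \<Longrightarrow> y $ v > 0" for A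
      using that(2) by (intro supp that(1)) (force simp: y_def)
  qed (simp add: y_def)
  moreover have "h * (\<Sum>v\<in>UNIV. \<mu> v * z $ v) \<le> (\<Sum>e\<in>E. w e * edge_diff z e)"
  proof (rule coarea_nonneg)
    show "h \<le> expansion E \<mu> w A" if "A \<noteq> {}" "\<And>v. v \<in> A \<Longrightarrow> z $ v > 0" for A
      using that(2) by (intro supp that(1)) (force simp: z_def)
  qed (simp add: z_def)
  moreover have "(\<Sum>v\<in>UNIV. \<mu> v * \<bar>x $ v\<bar>) = (\<Sum>v\<in>UNIV. \<mu> v * y $ v) + (\<Sum>v\<in>UNIV. \<mu> v * z $ v)"
    unfolding sum.distrib[symmetric] by (intro sum.cong) (auto simp: y_def z_def max_def)
  moreover have "edge_diff x e = edge_diff y e + edge_diff z e" if "e \<in> E" for e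
    using that by (rule edgeE) (auto simp: edge_diff_doubleton y_def z_def max_def)
  then have "(\<Sum>e\<in>E. w e * edge_diff x e) = (\<Sum>e\<in>E. w e * edge_diff y e) + (\<Sum>e\<in>E. w e * edge_diff z e)"
    unfolding sum.distrib[symmetric] by (intro sum.cong) (auto simp: algebra_simps)
  ultimately show ?thesis
    by (simp add: algebra_simps)
qed

end

text \<open>
  Graphs whose vertex weight is the weighted degree.
\<close>

locale degree_weighted_graph = weighted_graph E \<mu> w
  for E :: "'n::finite set set" and \<mu> :: "'n \<Rightarrow> real" and w :: "'n set \<Rightarrow> real" +
  assumes degree: "\<mu> v = (\<Sum>u | {u, v} \<in> E. w {u, v})"
begin

lemma sum_over_edge_ends: "(\<Sum>e\<in>E. w e * (\<Sum>v\<in>e. F v)) = (\<Sum>v\<in>UNIV. \<mu> v * F v)"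
  for F :: "'n \<Rightarrow> real"
proof -
  have "\<mu> v = (\<Sum>e\<in>E. if v \<in> e then w e else 0)" for v
  proof -
    have "bij_betw (\<lambda>u. {u, v}) {u. {u, v} \<in> E} {e \<in> E. v \<in> e}"
      unfolding bij_betw_def
    proof
      show "inj_on (\<lambda>u. {u, v}) {u. {u, v} \<in> E}"
        by (auto simp: inj_on_def doubleton_eq_iff)
      have "\<exists>u. e = {u, v}" if e: "e \<in> E" "v \<in> e" for e
        using e(1) by (rule edgeE) (use e(2) in auto)
      then show "(\<lambda>u. {u, v}) ` {u. {u, v} \<in> E} = {e \<in> E. v \<in> e}"
        by auto
    qed
    then have "\<mu> v = (\<Sum>e | e \<in> E \<and> v \<in> e. w e)"
      unfolding degree[of v] by (rule sum.reindex_bij_betw)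
    then show ?thesis
      by (simp add: sum.If_cases Collect_conj_eq)
  qed
  then have "(\<Sum>v\<in>UNIV. \<mu> v * F v) = (\<Sum>v\<in>UNIV. \<Sum>e\<in>E. if v \<in> e then w e * F v else 0)"
    by (intro sum.cong) (auto simp: sum_distrib_right intro!: sum.cong)
  also have "\<dots> = (\<Sum>e\<in>E. \<Sum>v\<in>UNIV. if v \<in> e then w e * F v else 0)"
    by (rule sum.swap)
  also have "\<dots> = (\<Sum>e\<in>E. w e * (\<Sum>v\<in>e. F v))"
    by (simp add: sum.If_cases sum_distrib_left)
  finally show ?thesis ..
qed

lemma p_energy_upper:
  assumes "p \<ge> 1"
  shows "(\<Sum>e\<in>E. w e * edge_diff x e powr p) \<le> 2 powr (p - 1) * (\<Sum>v\<in>UNIV. \<mu> v * \<bar>x $ v\<bar> powr p)"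
proof -
  have "w e * edge_diff x e powr p \<le> 2 powr (p - 1) * (w e * (\<Sum>v\<in>e. \<bar>x $ v\<bar> powr p))" if "e \<in> E" for e
    using that
  proof (rule edgeE)
    fix u v assume uv: "u \<noteq> v" "e = {u, v}" "w e > 0"
    have "w e * edge_diff x e powr p \<le> w e * (2 powr (p - 1) * (\<bar>x $ u\<bar> powr p + \<bar>x $ v\<bar> powr p))"
      using powr_abs_diff_le[OF assms, of "x $ u" "x $ v"] uv
      by (intro mult_left_mono) (auto simp: edge_diff_doubleton)
    then show ?thesis
      using uv by (simp add: mult_ac)
  qed
  then have "(\<Sum>e\<in>E. w e * edge_diff x e powr p)
      \<le> (\<Sum>e\<in>E. 2 powr (p - 1) * (w e * (\<Sum>v\<in>e. \<bar>x $ v\<bar> powr p)))"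
    by (rule sum_mono)
  then show ?thesis
    by (simp add: sum_over_edge_ends flip: sum_distrib_left)
qed

lemma p_norm_pos:
  assumes "x \<noteq> 0"
  shows "(\<Sum>v\<in>UNIV. \<mu> v * \<bar>x $ v\<bar> powr p) > 0"
proof -
  obtain v where "x $ v \<noteq> 0"
    using assms by (auto simp: vec_eq_iff)
  then show ?thesis
    by (intro sum_pos2[of _ v]) (simp_all add: vertex_weight_pos less_imp_le)
qed

lemma p_rayleigh_bounds:
  assumes "p \<ge> 1" "x \<noteq> 0"
  shows "0 \<le> p_rayleigh E \<mu> w p x" "p_rayleigh E \<mu> w p x \<le> 2 powr (p - 1)"
proof -
  have "0 \<le> (\<Sum>e\<in>E. w e * edge_diff x e powr p)"
    using edge_weight_pos by (intro sum_nonneg mult_nonneg_nonneg) (auto intro: less_imp_le)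
  then show "0 \<le> p_rayleigh E \<mu> w p x"
    using p_norm_pos[OF assms(2), of p] by (simp add: p_rayleigh_def)
  show "p_rayleigh E \<mu> w p x \<le> 2 powr (p - 1)"
    using p_norm_pos[OF assms(2), of p] p_energy_upper[OF assms(1), of x]
    by (simp add: p_rayleigh_def pos_divide_le_eq)
qed

text \<open>
  The coarea inequality for the signed power \<open>y\<close> of \<open>x\<close>, combined with \<open>signed_powr_diff_young\<close> on every
  edge.  Since the vertex weights are the degrees, the second term of the latter sums to
  \<open>(p - 1) / 2\<close> times the denominator \<open>M\<close> of the Rayleigh quotient.
\<close>

lemma p_rayleigh_lower:
  assumes p: "p \<ge> 1" and h: "h > 0" and "x \<noteq> 0"
    and supp: "\<And>A. A \<noteq> {} \<Longrightarrow> (\<And>v. v \<in> A \<Longrightarrow> x $ v \<noteq> 0) \<Longrightarrow> h \<le> expansion E \<mu> w A"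
  shows "2 powr (p - 1) / p powr p * h powr p \<le> p_rayleigh E \<mu> w p x"
proof -
  (* This c maximises (c h - (p - 1) / 2) / c^p, the constant that the argument yields. *)
  define c where "c = p / (2 * h)"
  define D where "D = (\<Sum>e\<in>E. w e * edge_diff x e powr p)"
  define M where "M = (\<Sum>v\<in>UNIV. \<mu> v * \<bar>x $ v\<bar> powr p)"
  define y :: "real ^ 'n" where "y = (\<chi> v. signed_powr p (x $ v))"
  have c: "c > 0" "c * h = p / 2"
    using p h by (auto simp: c_def)
  have "M > 0"
    unfolding M_def using \<open>x \<noteq> 0\<close> by (rule p_norm_pos)
  have y_abs: "\<bar>y $ v\<bar> = \<bar>x $ v\<bar> powr p" for v
    by (simp add: y_def signed_powr_def abs_mult abs_sgn_eq)
  have "h * (\<Sum>v\<in>UNIV. \<mu> v * \<bar>y $ v\<bar>) \<le> (\<Sum>e\<in>E. w e * edge_diff y e)"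
  proof (rule coarea)
    show "h \<le> expansion E \<mu> w A" if "A \<noteq> {}" "\<And>v. v \<in> A \<Longrightarrow> y $ v \<noteq> 0" for A
      using that(2) by (intro supp that(1)) (force simp: y_def signed_powr_def)
  qed
  then have "c * (h * M) \<le> c * (\<Sum>e\<in>E. w e * edge_diff y e)"
    using c(1) by (intro mult_left_mono) (auto simp: M_def y_abs)
  also have "\<dots> = (\<Sum>e\<in>E. w e * (c * edge_diff y e))"
    by (simp add: sum_distrib_left mult_ac)
  also have "\<dots> \<le> (\<Sum>e\<in>E. w e * (c powr p * edge_diff x e powr p + (p - 1) / 2 * (\<Sum>v\<in>e. \<bar>x $ v\<bar> powr p)))"
  proof (rule sum_mono)
    fix e assume "e \<in> E"
    then show "w e * (c * edge_diff y e)
        \<le> w e * (c powr p * edge_diff x e powr p + (p - 1) / 2 * (\<Sum>v\<in>e. \<bar>x $ v\<bar> powr p))"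
    proof (rule edgeE)
      fix u v assume "u \<noteq> v" "e = {u, v}" "w e > 0"
      then show ?thesis
        using signed_powr_diff_young[OF p, of c "x $ u" "x $ v"] c(1)
        by (intro mult_left_mono) (auto simp: edge_diff_doubleton y_def)
    qed
  qed
  also have "\<dots> = c powr p * D + (p - 1) / 2 * (\<Sum>e\<in>E. w e * (\<Sum>v\<in>e. \<bar>x $ v\<bar> powr p))"
    by (simp add: D_def sum.distrib sum_distrib_left algebra_simps)
  also have "\<dots> = c powr p * D + (p - 1) / 2 * M"
    by (simp add: sum_over_edge_ends M_def)
  finally have "p / 2 * M \<le> c powr p * D + (p - 1) / 2 * M"
    by (simp add: c(2) flip: mult.assoc)
  then have "M \<le> 2 * c powr p * D"
    by (simp add: field_simps)
  then have "K * M \<le> K * (2 * c powr p * D)" if "K \<ge> 0" for K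
    using that by (rule mult_left_mono)
  also have "K * (2 * c powr p * D) = (2 * c powr p * K) * D" for K
    by simp
  finally have "K * M \<le> (2 * c powr p * K) * D" if "K \<ge> 0" for K
    using that .
  moreover have "2 * c powr p * (2 powr (p - 1) / p powr p * h powr p) = 1"
    using p h by (simp add: c_def powr_divide powr_mult powr_diff)
  ultimately have "2 powr (p - 1) / p powr p * h powr p * M \<le> D"
    using divide_nonneg_nonneg[of "2 powr (p - 1)" "p powr p"]
    by (metis mult_nonneg_nonneg mult_1 powr_ge_zero)
  then show ?thesis
    using \<open>M > 0\<close> by (simp add: p_rayleigh_def D_def M_def pos_le_divide_eq)
qed

end

section \<open>Sets of small expansion\<close>

context weighted_graph
begin

text \<open>
  If no edge joined \<open>B\<close> to \<open>A - B\<close>, then the boundary of \<open>A\<close> would contain the disjoint boundaries of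
  the two parts, and \<open>\<phi> \<ge> h\<close> for both parts would give \<open>\<phi> \<ge> h\<close> for \<open>A\<close>.
\<close>

lemma minimal_low_expansion_inner_connected:
  assumes "A \<noteq> {}" and low: "expansion E \<mu> w A < h"
    and minimal: "\<And>B. B \<noteq> {} \<Longrightarrow> B \<subset> A \<Longrightarrow> h \<le> expansion E \<mu> w B"
  shows "inner_connected E A"
  unfolding inner_connected_def
proof (intro allI impI, rule ccontr)
  fix B assume B: "B \<noteq> {} \<and> B \<subset> A" and no: "\<not> (\<exists>u\<in>B. \<exists>v\<in>A - B. {u, v} \<in> E)"
  have diff: "A - B \<noteq> {}" "A - B \<subset> A"
    using B by auto
  have sub: "edge_boundary E B \<subseteq> edge_boundary E A" "edge_boundary E (A - B) \<subseteq> edge_boundary E A"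
  proof -
    have "e \<in> edge_boundary E A" if e: "e \<in> edge_boundary E B \<or> e \<in> edge_boundary E (A - B)" for e
    proof -
      have "e \<in> E"
        using e edge_boundary_subset by blast
      then obtain u v where uv: "e = {u, v}" "{u, v} \<in> E"
        by (rule edgeE)
      moreover have "{v, u} \<in> E"
        using uv(2) by (simp add: insert_commute)
      ultimately show ?thesis
        using e no B unfolding uv(1) edge_boundary_iff by blast
    qed
    then show "edge_boundary E B \<subseteq> edge_boundary E A" "edge_boundary E (A - B) \<subseteq> edge_boundary E A"
      by blast+
  qed
  have disj: "edge_boundary E B \<inter> edge_boundary E (A - B) = {}"
  proof (rule equals0I)
    fix e assume e: "e \<in> edge_boundary E B \<inter> edge_boundary E (A - B)"
    then have "e \<in> E"
      using edge_boundary_subset by blast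
    then obtain u v where uv: "e = {u, v}" "{u, v} \<in> E"
      by (rule edgeE)
    moreover have "{v, u} \<in> E"
      using uv(2) by (simp add: insert_commute)
    ultimately show False
      using e no B unfolding uv(1) Int_iff edge_boundary_iff by blast
  qed
  have "(\<Sum>v\<in>A. \<mu> v) = (\<Sum>v\<in>B. \<mu> v) + (\<Sum>v\<in>A - B. \<mu> v)"
    using B by (subst sum.subset_diff[of B A]) auto
  then have "h * (\<Sum>v\<in>A. \<mu> v) = h * (\<Sum>v\<in>B. \<mu> v) + h * (\<Sum>v\<in>A - B. \<mu> v)"
    by (simp only: distrib_left)
  also have "\<dots> \<le> (\<Sum>e\<in>edge_boundary E B. w e) + (\<Sum>e\<in>edge_boundary E (A - B). w e)"
  proof (rule add_mono)
    show "h * (\<Sum>v\<in>B. \<mu> v) \<le> (\<Sum>e\<in>edge_boundary E B. w e)"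
      using minimal[of B] B expansion_ge_iff[of B h] by simp
    show "h * (\<Sum>v\<in>A - B. \<mu> v) \<le> (\<Sum>e\<in>edge_boundary E (A - B). w e)"
      using minimal[OF diff] by (simp only: expansion_ge_iff[OF diff(1)])
  qed
  also have "\<dots> = (\<Sum>e\<in>edge_boundary E B \<union> edge_boundary E (A - B). w e)"
    using disj by (simp add: sum.union_disjoint)
  also have "\<dots> \<le> (\<Sum>e\<in>edge_boundary E A. w e)"
  proof (rule sum_mono2)
    fix e assume "e \<in> edge_boundary E A - (edge_boundary E B \<union> edge_boundary E (A - B))"
    then have "e \<in> E"
      using edge_boundary_subset[of E A] by blast
    then show "0 \<le> w e"
      using edge_weight_pos[of e] by simp
  qed (use sub in auto)
  finally have "h \<le> expansion E \<mu> w A"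
    by (simp only: expansion_ge_iff[OF \<open>A \<noteq> {}\<close>])
  then show False
    using low by simp
qed

lemma cheeger_constant_le:
  assumes "1 \<le> k" "\<And>i. i \<in> {1..k} \<Longrightarrow> A i \<noteq> {}" "disjoint_family_on A {1..k}"
    and "\<And>i. i \<in> {1..k} \<Longrightarrow> expansion E \<mu> w (A i) < h"
  shows "cheeger_constant E \<mu> w k < h"
proof -
  have "cheeger_constant E \<mu> w k \<le> Max ((\<lambda>i. expansion E \<mu> w (A i)) ` {1..k})"
    unfolding cheeger_constant_def using assms(2,3)
    by (intro Min_le finite_cheeger_values[OF assms(1)]) auto
  also have "\<dots> < h"
    using assms(1,4) by (subst Max_less_iff) auto
  finally show ?thesis .
qed

lemma cheeger_constant_attained:
  assumes "1 \<le> k" "k \<le> CARD('n)"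
  obtains A where "\<And>i. i \<in> {1..k} \<Longrightarrow> A i \<noteq> {}" "disjoint_family_on A {1..k}"
    "\<And>i. i \<in> {1..k} \<Longrightarrow> expansion E \<mu> w (A i) \<le> cheeger_constant E \<mu> w k"
    "0 \<le> cheeger_constant E \<mu> w k"
proof -
  define V where "V = {Max ((\<lambda>i. expansion E \<mu> w (A i)) ` {1..k}) | A.
            (\<forall>i\<in>{1..k}. A i \<noteq> {}) \<and> disjoint_family_on A {1..k}}"
  obtain b where b: "bij_betw b {1..CARD('n)} (UNIV :: 'n set)"
    using ex_bij_betw_nat_finite_1[of "UNIV :: 'n set"] by auto
  have "inj_on b {1..k}"
    using assms(2) by (intro inj_on_subset[OF bij_betw_imp_inj_on[OF b]]) auto
  then have "disjoint_family_on (\<lambda>i. {b i}) {1..k}"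
    by (simp add: disjoint_family_on_def inj_on_eq_iff)
  then have "Max ((\<lambda>i. expansion E \<mu> w {b i}) ` {1..k}) \<in> V"
    unfolding V_def by (intro CollectI exI[of _ "\<lambda>i. {b i}"] conjI refl) simp_all
  moreover have "finite V"
    unfolding V_def by (rule finite_cheeger_values[OF assms(1)])
  ultimately have "cheeger_constant E \<mu> w k \<in> V"
    unfolding cheeger_constant_def V_def[symmetric] by (intro Min_in) auto
  then obtain A where A: "\<forall>i\<in>{1..k}. A i \<noteq> {}" "disjoint_family_on A {1..k}"
    "cheeger_constant E \<mu> w k = Max ((\<lambda>i. expansion E \<mu> w (A i)) ` {1..k})"
    unfolding V_def by blast
  have le: "expansion E \<mu> w (A i) \<le> cheeger_constant E \<mu> w k" if "i \<in> {1..k}" for i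
    unfolding A(3) using that by (intro Max_ge) auto
  moreover have "0 \<le> cheeger_constant E \<mu> w k"
    using le[of 1] expansion_nonneg[of "A 1"] assms(1) by simp
  ultimately show thesis
    using A(1,2) by (intro that[of A]) auto
qed

lemma cycle_rank_nonneg: "0 \<le> cycle_rank E"
proof -
  have "{} \<notin> E"
    using edge by auto
  then obtain U :: "'n set" where "int (card U) \<le> cycle_rank E"
    by (rule feedback_vertex_cover)
  then show ?thesis
    by (rule order_trans[rotated]) simp
qed

text \<open>
  With \<open>U\<close> from \<open>feedback_vertex_cover\<close>, the minimal sets of expansion below \<open>h\<close> that avoid \<open>U\<close> are
  subtrees of a forest, no \<open>m\<close> of which are disjoint.  The hitting set is \<open>U\<close> together with a cover of
  these subtrees.
\<close>

lemma cheeger_hitting_set: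
  assumes "1 \<le> m"
  obtains W :: "'n set" where "int (card W) < cycle_rank E + int m"
    "\<And>A. A \<noteq> {} \<Longrightarrow> A \<inter> W = {} \<Longrightarrow> cheeger_constant E \<mu> w m \<le> expansion E \<mu> w A"
proof -
  define h where "h = cheeger_constant E \<mu> w m"
  have "{} \<notin> E"
    using edge by auto
  then obtain N U and par :: "'n \<Rightarrow> 'n" and d :: "'n \<Rightarrow> nat" where
    forest: "\<And>v. v \<in> N \<Longrightarrow> d (par v) < d v" and U: "int (card U) \<le> cycle_rank E"
    and tree: "\<And>A. A \<inter> U = {} \<Longrightarrow> inner_connected E A \<Longrightarrow> inner_connected {{v, par v} | v. v \<in> N} A"
    by (rule feedback_vertex_cover) (rule that)
  define low where "low = (\<lambda>A. A \<noteq> {} \<and> A \<inter> U = {} \<and> expansion E \<mu> w A < h)"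
  define F where "F = {A. low A \<and> (\<forall>B. B \<subset> A \<longrightarrow> \<not> low B)}"
  have F_conn: "inner_connected {{v, par v} | v. v \<in> N} A" if "A \<in> F" for A
  proof (rule tree)
    show "A \<inter> U = {}"
      using that by (simp add: F_def low_def)
    show "inner_connected E A"
    proof (rule minimal_low_expansion_inner_connected[where h = h])
      show "A \<noteq> {}" "expansion E \<mu> w A < h"
        using that by (auto simp: F_def low_def)
      fix B assume B: "B \<noteq> {}" "B \<subset> A"
      then have "\<not> low B" "B \<inter> U = {}"
        using that by (auto simp: F_def low_def)
      then show "h \<le> expansion E \<mu> w B"
        using B(1) by (simp add: low_def)
    qed
  qed
  have "finite F" by simp
  moreover have "A \<noteq> {}" if "A \<in> F" for A
    using that by (simp add: F_def low_def)
  ultimately have "\<exists>P W. P \<subseteq> F \<and> disjoint P \<and> card W \<le> card P \<and> (\<forall>A\<in>F. A \<inter> W \<noteq> {})"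
    using F_conn by (intro subtree_packing_covering[where N = N and d = d and par = par] forest)
  then obtain P W where PW: "P \<subseteq> F" "disjoint P" "card W \<le> card P" "\<And>A. A \<in> F \<Longrightarrow> A \<inter> W \<noteq> {}"
    by blast
  have "card P < m"
  proof (rule ccontr)
    assume "\<not> card P < m"
    then obtain Q where Q: "Q \<subseteq> P" "card Q = m"
      using obtain_subset_with_card_n[of m P] by (auto simp: not_less)
    have "finite Q"
      by simp
    then obtain A where A: "bij_betw A {1..m} Q"
      using ex_bij_betw_nat_finite_1[of Q] Q(2) by auto
    have AF: "A i \<in> F" if "i \<in> {1..m}" for i
    proof -
      have "A i \<in> Q"
        using that A by (rule bij_betw_apply[rotated])
      then show ?thesis
        using Q(1) PW(1) by blast
    qed
    have "disjoint_family_on A {1..m}"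
      unfolding disjoint_family_on_def
    proof (intro ballI impI)
      fix i j assume ij: "i \<in> {1..m}" "j \<in> {1..m}" "i \<noteq> j"
      then have "A i \<noteq> A j"
        using bij_betw_imp_inj_on[OF A] by (simp add: inj_on_eq_iff)
      moreover have "A i \<in> P" "A j \<in> P"
        using bij_betw_apply[OF A ij(1)] bij_betw_apply[OF A ij(2)] Q(1) by blast+
      ultimately show "A i \<inter> A j = {}"
        using pairwiseD[OF PW(2)] by (simp add: disjnt_def)
    qed
    then have "cheeger_constant E \<mu> w m < h"
      using AF by (intro cheeger_constant_le assms) (auto simp: F_def low_def)
    then show False
      by (simp add: h_def)
  qed
  have hit: "h \<le> expansion E \<mu> w A" if A: "A \<noteq> {}" "A \<inter> (U \<union> W) = {}" for A
  proof (rule ccontr)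
    assume "\<not> h \<le> expansion E \<mu> w A"
    then have "low A"
      using A by (auto simp: low_def)
    then obtain B where B: "low B \<and> B \<subseteq> A" "\<And>C. low C \<and> C \<subseteq> A \<Longrightarrow> card B \<le> card C"
      using ex_has_least_nat[of "\<lambda>B. low B \<and> B \<subseteq> A" A card] by blast
    have "\<not> low C" if "C \<subset> B" for C
      using B that psubset_card_mono[of B C] by fastforce
    then have "B \<in> F"
      using B(1) by (simp add: F_def)
    then show False
      using PW(4)[of B] B(1) A(2) by blast
  qed
  have "card (U \<union> W) \<le> card U + card W"
    by (rule card_Un_le)
  then have "int (card (U \<union> W)) < cycle_rank E + int m"
    using U PW(3) \<open>card P < m\<close> by linarith
  then show thesis
    using hit unfolding h_def by (rule that)
qed

end

section \<open>Spans of disjoint indicator functions\<close>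

context degree_weighted_graph
begin

text \<open>
  An edge inside some \<open>A\<^sub>i\<close> contributes nothing, and any other edge lies in the boundary of \<open>A\<^sub>i\<close> exactly
  when one of its ends is in \<open>A\<^sub>i\<close>; so \<open>\<bar>t\<^sub>i\<bar>\<^sup>p\<close> is charged once for each such end.
\<close>

lemma p_rayleigh_disjoint_span:
  assumes p: "p \<ge> 1" and "finite I"
    and ne: "\<And>i. i \<in> I \<Longrightarrow> A i \<noteq> {}" and disj: "disjoint_family_on A I"
    and h: "\<And>i. i \<in> I \<Longrightarrow> expansion E \<mu> w (A i) \<le> h"
    and x: "x = (\<chi> v. \<Sum>i\<in>I. t i * indicat_real (A i) v)" and "x \<noteq> 0"
  shows "p_rayleigh E \<mu> w p x \<le> 2 powr (p - 1) * h"
proof -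
  have uniq: "i = j" if "i \<in> I" "j \<in> I" "v \<in> A i" "v \<in> A j" for i j v
    using disj that unfolding disjoint_family_on_def by blast
  have x_eq: "x $ v = t j" if "j \<in> I" "v \<in> A j" for j v
  proof -
    have "x $ v = (\<Sum>i\<in>I. if i = j then t i else 0)"
      unfolding x vec_lambda_beta
    proof (rule sum.cong)
      show "t i * indicat_real (A i) v = (if i = j then t i else 0)" if "i \<in> I" for i
        using uniq[OF that \<open>j \<in> I\<close> _ \<open>v \<in> A j\<close>] \<open>v \<in> A j\<close> by (cases "v \<in> A i") auto
    qed simp
    then show ?thesis
      using that \<open>finite I\<close> by simp
  qed
  have powr_eq: "\<bar>x $ v\<bar> powr p = (\<Sum>i\<in>I. \<bar>t i\<bar> powr p * indicat_real (A i) v)" for v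
  proof (cases "\<exists>j\<in>I. v \<in> A j")
    case True
    then obtain j where j: "j \<in> I" "v \<in> A j"
      by blast
    have "(\<Sum>i\<in>I. \<bar>t i\<bar> powr p * indicat_real (A i) v) = (\<Sum>i\<in>I. if i = j then \<bar>t i\<bar> powr p else 0)"
    proof (rule sum.cong)
      show "\<bar>t i\<bar> powr p * indicat_real (A i) v = (if i = j then \<bar>t i\<bar> powr p else 0)" if "i \<in> I" for i
        using uniq[OF that j(1) _ j(2)] j(2) by (cases "v \<in> A i") auto
    qed simp
    then show ?thesis
      using x_eq[OF j] j(1) \<open>finite I\<close> by simp
  next
    case False
    then show ?thesis
      by (simp add: x)
  qed
  have edge_le: "edge_diff x e powr p
      \<le> 2 powr (p - 1) * (\<Sum>i\<in>I. \<bar>t i\<bar> powr p * indicat_real (edge_boundary E (A i)) e)" if "e \<in> E" for e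
    using that
  proof (rule edgeE)
    fix u v assume uv: "e = {u, v}" "{u, v} \<in> E"
    show ?thesis
    proof (cases "\<exists>i\<in>I. u \<in> A i \<and> v \<in> A i")
      case True
      then obtain i where "i \<in> I" "u \<in> A i" "v \<in> A i"
        by blast
      then have "x $ u = x $ v"
        by (simp add: x_eq)
      then show ?thesis
        by (simp add: uv(1) edge_diff_doubleton sum_nonneg)
    next
      case False
      have "(\<Sum>i\<in>I. \<bar>t i\<bar> powr p * indicat_real (edge_boundary E (A i)) e)
          = (\<Sum>i\<in>I. \<bar>t i\<bar> powr p * indicat_real (A i) u + \<bar>t i\<bar> powr p * indicat_real (A i) v)"
        using False uv by (intro sum.cong) (auto simp: indicator_def edge_boundary_iff)
      also have "\<dots> = \<bar>x $ u\<bar> powr p + \<bar>x $ v\<bar> powr p"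
        by (simp add: powr_eq sum.distrib)
      finally show ?thesis
        using powr_abs_diff_le[OF p, of "x $ u" "x $ v"] by (simp add: uv(1) edge_diff_doubleton)
    qed
  qed
  have "(\<Sum>e\<in>E. w e * edge_diff x e powr p)
      \<le> (\<Sum>e\<in>E. w e * (2 powr (p - 1) * (\<Sum>i\<in>I. \<bar>t i\<bar> powr p * indicat_real (edge_boundary E (A i)) e)))"
    using edge_le edge_weight_pos by (intro sum_mono mult_left_mono) (auto intro: less_imp_le)
  also have "\<dots> = (\<Sum>e\<in>E. \<Sum>i\<in>I. 2 powr (p - 1) * \<bar>t i\<bar> powr p * (w e * indicat_real (edge_boundary E (A i)) e))"
    by (simp add: sum_distrib_left mult_ac)
  also have "\<dots> = (\<Sum>i\<in>I. \<Sum>e\<in>E. 2 powr (p - 1) * \<bar>t i\<bar> powr p * (w e * indicat_real (edge_boundary E (A i)) e))"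
    by (rule sum.swap)
  also have "\<dots> \<le> (\<Sum>i\<in>I. \<Sum>v\<in>UNIV. 2 powr (p - 1) * h * (\<mu> v * (\<bar>t i\<bar> powr p * indicat_real (A i) v)))"
  proof (rule sum_mono)
    fix i assume i: "i \<in> I"
    have "(\<Sum>e\<in>E. w e * indicat_real (edge_boundary E (A i)) e) = (\<Sum>e\<in>edge_boundary E (A i). w e)"
      using edge_boundary_subset by (intro sum.mono_neutral_cong_right) auto
    also have "\<dots> \<le> h * (\<Sum>v\<in>A i. \<mu> v)"
      using h[OF i] by (simp only: expansion_le_iff[OF ne[OF i]])
    also have "(\<Sum>v\<in>A i. \<mu> v) = (\<Sum>v\<in>UNIV. \<mu> v * indicat_real (A i) v)"
      by (intro sum.mono_neutral_cong_left) auto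
    finally have "2 powr (p - 1) * \<bar>t i\<bar> powr p * (\<Sum>e\<in>E. w e * indicat_real (edge_boundary E (A i)) e)
        \<le> 2 powr (p - 1) * \<bar>t i\<bar> powr p * (h * (\<Sum>v\<in>UNIV. \<mu> v * indicat_real (A i) v))"
      by (intro mult_left_mono) auto
    then show "(\<Sum>e\<in>E. 2 powr (p - 1) * \<bar>t i\<bar> powr p * (w e * indicat_real (edge_boundary E (A i)) e))
        \<le> (\<Sum>v\<in>UNIV. 2 powr (p - 1) * h * (\<mu> v * (\<bar>t i\<bar> powr p * indicat_real (A i) v)))"
      by (simp only: sum_distrib_left mult_ac)
  qed
  also have "\<dots> = (\<Sum>v\<in>UNIV. \<Sum>i\<in>I. 2 powr (p - 1) * h * (\<mu> v * (\<bar>t i\<bar> powr p * indicat_real (A i) v)))"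
    by (rule sum.swap)
  also have "\<dots> = 2 powr (p - 1) * h * (\<Sum>v\<in>UNIV. \<mu> v * \<bar>x $ v\<bar> powr p)"
    by (simp only: powr_eq sum_distrib_left)
  finally show ?thesis
    using p_norm_pos[OF \<open>x \<noteq> 0\<close>, of p] by (simp add: p_rayleigh_def pos_divide_le_eq)
qed

text \<open>
  The unit sphere of the span of the indicator functions, as the image of the standard sphere under
  the map from coefficient vectors to functions.
\<close>

lemma disjoint_sets_sphere:
  fixes A :: "nat \<Rightarrow> 'n set"
  assumes k: "1 \<le> k" "k \<le> CARD('n)"
    and ne: "\<And>i. i \<in> {1..k} \<Longrightarrow> A i \<noteq> {}" and disj: "disjoint_family_on A {1..k}"
  obtains S where "compact S" "S \<noteq> {}" "0 \<notin> S" "uminus ` S = S" "genus S \<ge> k"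
    "\<And>x. x \<in> S \<Longrightarrow> \<exists>t. x = (\<chi> v. \<Sum>i\<in>{1..k}. t i * indicat_real (A i) v)"
proof -
  define n where "n = k - 1"
  have n: "k = Suc n"
    using k by (simp add: n_def)
  define \<iota> :: "(nat \<Rightarrow> real) \<Rightarrow> real ^ 'n" where
    "\<iota> = (\<lambda>t. \<chi> v. \<Sum>i\<in>{1..k}. t (i - 1) * indicat_real (A i) v)"
  define T where "T = topspace (nsphere n)"
  define S where "S = \<iota> ` T"
  have odd: "\<iota> (\<lambda>i. - t i) = - \<iota> t" for t
    by (simp add: \<iota>_def vec_eq_iff sum_negf)
  have nz: "\<iota> t \<noteq> 0" if t: "t \<in> T" for t
  proof -
    have "t \<noteq> (\<lambda>i. 0)"
      using t by (auto simp: T_def topspace_nsphere_iff)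
    then obtain j where "t j \<noteq> 0"
      by auto
    moreover then have "j \<le> n"
      using t by (auto simp: T_def topspace_nsphere_iff not_less[symmetric])
    ultimately have j: "Suc j \<in> {1..k}" "t j \<noteq> 0"
      by (auto simp: n)
    obtain v where v: "v \<in> A (Suc j)"
      using ne[OF j(1)] by blast
    have uniq: "i = Suc j" if "i \<in> {1..k}" "v \<in> A i" for i
      using disj v j(1) that unfolding disjoint_family_on_def by blast
    have "\<iota> t $ v = (\<Sum>i\<in>{1..k}. if i = Suc j then t j else 0)"
      unfolding \<iota>_def vec_lambda_beta
    proof (rule sum.cong)
      show "t (i - 1) * indicat_real (A i) v = (if i = Suc j then t j else 0)" if "i \<in> {1..k}" for i
        using uniq[OF that] v by (cases "v \<in> A i") auto
    qed simp
    then have "\<iota> t $ v = t j"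
      using j(1) by simp
    then show ?thesis
      using j(2) by auto
  qed
  have cont: "continuous_on T \<iota>"
    unfolding \<iota>_def
    by (intro continuous_intros continuous_on_vec_lambda continuous_on_coordinate[OF continuous_on_id])
  (* Compactness of the standard sphere comes from its homeomorphism with a Euclidean sphere. *)
  obtain B :: "(real ^ 'n) set" where B: "B \<subseteq> Basis" "card B = k"
    using obtain_subset_with_card_n[of k "Basis :: (real ^ 'n) set"] k(2) by auto
  then have "independent B" "pairwise orthogonal B" "\<And>u. u \<in> B \<Longrightarrow> norm u = 1"
    using independent_mono[OF independent_Basis] pairwise_mono[OF orthogonal_Basis] by auto
  then obtain f :: "(nat \<Rightarrow> real) \<Rightarrow> real ^ 'n" and g
    where "homeomorphic_maps (nsphere (k - 1)) (top_of_set (sphere 0 1 \<inter> span B)) f g"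
    using homeomorphic_maps_nsphere_euclidean_sphere[of B k] B(2) k(1) by auto
  then have fg: "homeomorphic_maps (nsphere n) (top_of_set (sphere 0 1 \<inter> span B)) f g"
    by (simp add: n_def)
  have "compact (sphere 0 1 \<inter> span B)"
    by (intro compact_Int_closed closed_span) simp
  moreover have "continuous_on (sphere 0 1 \<inter> span B) g" "g ` (sphere 0 1 \<inter> span B) = T"
  proof -
    have "continuous_map (top_of_set (sphere 0 1 \<inter> span B)) (nsphere n) g"
      using fg by (simp add: homeomorphic_maps_def)
    then show "continuous_on (sphere 0 1 \<inter> span B) g"
      by (subst (asm) nsphere_eq_top_of_set) simp
    have "homeomorphic_map (top_of_set (sphere 0 1 \<inter> span B)) (nsphere n) g"
      using fg homeomorphic_maps_map homeomorphic_maps_sym by blast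
    then show "g ` (sphere 0 1 \<inter> span B) = T"
      using homeomorphic_imp_surjective_map by (fastforce simp: T_def)
  qed
  ultimately have "compact T"
    by (metis compact_continuous_image)
  then have "compact S"
    unfolding S_def using cont by (intro compact_continuous_image)
  moreover have "S \<noteq> {}"
    using in_topspace_nsphere by (auto simp: S_def T_def)
  moreover have "0 \<notin> S"
    using nz by (auto simp: S_def)
  moreover have "uminus ` S = S"
  proof -
    have sub: "uminus ` S \<subseteq> S"
      using uminus_in_nsphere by (force simp: S_def T_def odd[symmetric])
    then have "uminus ` uminus ` S \<subseteq> uminus ` S"
      by (rule image_mono)
    with sub show ?thesis
      by (simp add: image_image)
  qed
  moreover have "genus S \<ge> k"
    unfolding n S_def T_def
    by (rule genus_odd_sphere_image) (use k n nz odd cont in \<open>auto simp: T_def\<close>)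
  moreover have "\<exists>t. x = (\<chi> v. \<Sum>i\<in>{1..k}. t i * indicat_real (A i) v)" if "x \<in> S" for x
    using that by (auto simp: S_def \<iota>_def)
  ultimately show thesis
    by (rule that)
qed

end

section \<open>Cheeger inequalities for the graph p-Laplacian\<close>

theorem theorem7:
  fixes E :: "'n::finite set set" and \<mu> :: "'n \<Rightarrow> real" and w :: "'n set \<Rightarrow> real"
    and p :: real and k :: nat
  assumes "weighted_graph E \<mu> w"
    and "\<And>v. \<mu> v = (\<Sum>u | {u, v} \<in> E. w {u, v})"
    and "p \<ge> 1"
    and "k \<in> {1..CARD('n)}"
  shows "minmax_eigenvalue E \<mu> w p k \<le> 2 powr (p - 1) * cheeger_constant E \<mu> w k \<and>
    (int k - cycle_rank E \<ge> 1 \<longrightarrow>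
       2 powr (p - 1) / p powr p * cheeger_constant E \<mu> w (nat (int k - cycle_rank E)) powr p
         \<le> minmax_eigenvalue E \<mu> w p k)"
proof -
  interpret degree_weighted_graph E \<mu> w
    by (intro degree_weighted_graph.intro degree_weighted_graph_axioms.intro assms(1,2))
  have p: "p \<ge> 1" and k: "1 \<le> k" "k \<le> CARD('n)"
    using assms(3,4) by auto
  define \<S> :: "(real ^ 'n) set set" where
    "\<S> = {S. S \<noteq> {} \<and> compact S \<and> 0 \<notin> S \<and> uminus ` S = S \<and> genus S \<ge> k}"
  define R where "R = p_rayleigh E \<mu> w p"
  have eigenvalue: "minmax_eigenvalue E \<mu> w p k = (INF S\<in>\<S>. SUP x\<in>S. R x)"
    by (simp add: minmax_eigenvalue_def \<S>_def R_def)
  have R_bounds: "0 \<le> R x" "R x \<le> 2 powr (p - 1)" if "S \<in> \<S>" "x \<in> S" for S x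
    using that p_rayleigh_bounds[OF p, of x] by (auto simp: \<S>_def R_def)
  have bdd: "bdd_above (R ` S)" if "S \<in> \<S>" for S
    using R_bounds(2)[OF that] by (intro bdd_aboveI2) auto
  have SUP_ge: "c \<le> (SUP x\<in>S. R x)" if "S \<in> \<S>" "x \<in> S" "c \<le> R x" for S x c
    using that bdd by (intro cSUP_upper2)
  have bdd': "bdd_below ((\<lambda>S. SUP x\<in>S. R x) ` \<S>)"
  proof (rule bdd_belowI2)
    fix S assume S: "S \<in> \<S>"
    then obtain x where "x \<in> S"
      by (auto simp: \<S>_def)
    then show "0 \<le> (SUP x\<in>S. R x)"
      using S R_bounds(1) by (intro SUP_ge)
  qed

  (* The set S below proves the upper bound, and also that the infimum is over a nonempty family. *)
  obtain A where A: "\<And>i. i \<in> {1..k} \<Longrightarrow> A i \<noteq> {}" "disjoint_family_on A {1..k}"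
    "\<And>i. i \<in> {1..k} \<Longrightarrow> expansion E \<mu> w (A i) \<le> cheeger_constant E \<mu> w k"
    by (rule cheeger_constant_attained[OF k]) (rule that)
  obtain S where S: "compact S" "S \<noteq> {}" "0 \<notin> S" "uminus ` S = S" "genus S \<ge> k"
    "\<And>x. x \<in> S \<Longrightarrow> \<exists>t. x = (\<chi> v. \<Sum>i\<in>{1..k}. t i * indicat_real (A i) v)"
  proof (rule disjoint_sets_sphere[OF k _ A(2)])
    show "A i \<noteq> {}" if "i \<in> {1..k}" for i
      using that by (rule A(1))
  qed (rule that)
  have "S \<in> \<S>"
    using S by (simp add: \<S>_def)
  have "R x \<le> 2 powr (p - 1) * cheeger_constant E \<mu> w k" if x: "x \<in> S" for x
  proof -
    obtain t where "x = (\<chi> v. \<Sum>i\<in>{1..k}. t i * indicat_real (A i) v)"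
      using S(6)[OF x] by blast
    moreover have "x \<noteq> 0"
      using x S(3) by blast
    ultimately show ?thesis
      unfolding R_def using A by (intro p_rayleigh_disjoint_span[OF p]) auto
  qed
  then have "(SUP x\<in>S. R x) \<le> 2 powr (p - 1) * cheeger_constant E \<mu> w k"
    using S(2) by (intro cSUP_least)
  then have upper: "minmax_eigenvalue E \<mu> w p k \<le> 2 powr (p - 1) * cheeger_constant E \<mu> w k"
    unfolding eigenvalue using \<open>S \<in> \<S>\<close> bdd' by (intro cINF_lower2)

  have lower: "2 powr (p - 1) / p powr p * cheeger_constant E \<mu> w m powr p \<le> minmax_eigenvalue E \<mu> w p k"
    if m: "1 \<le> m" "int m = int k - cycle_rank E" for m
    unfolding eigenvalue
  proof (rule cINF_greatest)
    show "\<S> \<noteq> {}"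
      using \<open>S \<in> \<S>\<close> by blast
    fix S assume S: "S \<in> \<S>"
    define h where "h = cheeger_constant E \<mu> w m"
    have "m \<le> CARD('n)"
      using m(2) cycle_rank_nonneg k(2) by linarith
    then have "h \<ge> 0"
      unfolding h_def by (rule cheeger_constant_attained[OF m(1)])
    obtain W :: "'n set" where W: "int (card W) < cycle_rank E + int m"
      "\<And>A. A \<noteq> {} \<Longrightarrow> A \<inter> W = {} \<Longrightarrow> h \<le> expansion E \<mu> w A"
      by (rule cheeger_hitting_set[OF m(1), folded h_def]) (rule that)
    have "S \<noteq> {}" "card W < genus S"
      using W(1) m(2) S by (auto simp: \<S>_def)
    then obtain x where x: "x \<in> S" "\<And>v. v \<in> W \<Longrightarrow> x $ v = 0"
      by (rule vanishing_point_if_genus_large) (rule that)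
    have "2 powr (p - 1) / p powr p * h powr p \<le> R x"
    (* For h = 0 the coarea argument has no admissible c, but the bound is 0. *)
    proof (cases "h = 0")
      case True
      then show ?thesis
        using R_bounds(1)[OF S x(1)] by simp
    next
      case False
      have "x \<noteq> 0"
        using S x(1) by (auto simp: \<S>_def)
      then show ?thesis
        unfolding R_def
      proof (rule p_rayleigh_lower[OF p, rotated])
        show "h > 0"
          using False \<open>h \<ge> 0\<close> by simp
        show "h \<le> expansion E \<mu> w A" if "A \<noteq> {}" "\<And>v. v \<in> A \<Longrightarrow> x $ v \<noteq> 0" for A
          using that x(2) by (intro W(2)) blast+
      qed
    qed
    then show "2 powr (p - 1) / p powr p * cheeger_constant E \<mu> w m powr p \<le> (SUP x\<in>S. R x)"
      unfolding h_def using S x(1) by (intro SUP_ge)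
  qed
  show ?thesis
    using upper lower[of "nat (int k - cycle_rank E)"] by simp
qed

end
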